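(* Let $n$, $k := k(n)$ and $s := s(n)$ be positive integers satisfying $k \leq s/17$. (a) Let $G = (V,E)$ be an $n$-vertex graph satisfying $\delta(G) = s$, where $s = o(n)$. Then, asymptotically almost surely $\kappa(G \cup \mathbb{G}(n,p)) \geq k$ holds, whenever $p := p(n) \geq \frac{c(k + \log(n/s))}{ns}$ and $c$ is a sufficiently large constant. (b) There exists an $n$-vertex graph $G_0$ satisfying $\delta(G_0) \geq s$ such that $\kappa(G_0 \cup H) < k$ holds, whenever $H$ is a graph having fewer than $k \lfloor n/(s+1) \rfloor / 2$ edges. Moreover, if $\omega(1) = s = o(n)$, then $\kappa(G_0 \cup \mathbb{G}(n,p)) = 0$ holds asymptotically almost surely whenever $p := p(n) \leq \frac{(1 - o(1)) \log(n/s)}{ns}$.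
   Context: $\mathbb{G}(n,p)$ is the binomial random graph on the same $n$-element vertex set as the graph being perturbed (each pair of vertices is an edge independently with probability $p$), and $G \cup \mathbb{G}(n,p)$ denotes the random graph $G \cup R$ (union of edge sets) with $R \sim \mathbb{G}(n,p)$. Likewise, $G_0 \cup H$ is the union of edge sets, where $H$ is an $n$-vertex graph on the vertex set of $G_0$. $\delta$ denotes minimum degree and $\kappa$ denotes vertex-connectivity; in particular $\kappa = 0$ for a disconnected graph. "Asymptotically almost surely" means with probability tending to $1$ as $n \to \infty$. $s = o(n)$ means $s(n)/n \to 0$, $s = \omega(1)$ means $s(n) \to \infty$, and $o(1)$ denotes a quantity tending to $0$, all as $n \to \infty$. $\log$ is the natural logarithm.
   Formalization: The first claim of (b) is stated for n ≥ 2(s+1), i.e. ⌊n/(s+1)⌋ ≥ 2; without such a bound it is false: no such graph exists for n ≤ s, and for s < n < 2(s+1), k = 1, every graph with minimum degree ≥ s is connected. *)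

theory Defs
  imports "HOL-Library.Ramsey" "HOL-Probability.Probability" "HOL-Probability.Product_PMF"
begin

definition simple_graph :: "'a set \<Rightarrow> 'a set set \<Rightarrow> bool" where
  "simple_graph V E \<longleftrightarrow> finite V \<and> E \<subseteq> [V]\<^bsup>2\<^esup>"

definition degree :: "'a set set \<Rightarrow> 'a \<Rightarrow> nat" where
  "degree E v = card {e \<in> E. v \<in> e}"

text \<open>Only meaningful for a nonempty vertex set.\<close>
definition min_degree :: "'a set \<Rightarrow> 'a set set \<Rightarrow> nat" where
  "min_degree V E = Min (degree E ` V)"

definition connected_graph :: "'a set \<Rightarrow> 'a set set \<Rightarrow> bool" where
  "connected_graph V E \<longleftrightarrow>
     (\<forall>u\<in>V. \<forall>v\<in>V. (u, v) \<in> {(x, y). x \<in> V \<and> y \<in> V \<and> {x, y} \<in> E}\<^sup>*)"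

text \<open>The least number of vertices whose deletion leaves a graph that is disconnected or has at
  most one vertex. Thus \<open>K\<^sub>n\<close> has connectivity \<open>n - 1\<close> for \<open>n \<ge> 1\<close>, and
  disconnected graphs have connectivity \<open>0\<close>.\<close>
definition vertex_connectivity :: "'a set \<Rightarrow> 'a set set \<Rightarrow> nat" where
  "vertex_connectivity V E =
     (LEAST m. \<exists>S\<subseteq>V. card S = m \<and>
        (\<not> connected_graph (V - S) {e \<in> E. e \<subseteq> V - S} \<or> card (V - S) \<le> 1))"

text \<open>The distribution of the edge set of the binomial random graph on \<open>{..<n}\<close>.\<close>
definition binomial_random_graph :: "nat \<Rightarrow> real \<Rightarrow> nat set set pmf" where
  "binomial_random_graph n p =
     map_pmf (\<lambda>f. {e \<in> [{..<n}]\<^bsup>2\<^esup>. f e})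
       (Pi_pmf ([{..<n}]\<^bsup>2\<^esup>) False (\<lambda>_. bernoulli_pmf p))"

end

theory Submission
  imports Defs
begin

text \<open>For (a), Mader's theorem provides a maximal family of disjoint cells of \<open>G\<close>: sets of more than
  \<open>(s - 2k) / 2\<close> vertices that no deletion of fewer than \<open>k\<close> vertices disconnects. There are
  \<open>O(n/s)\<close> of them. If \<open>S\<close> with \<open>card S < k\<close> separates \<open>A\<close> from \<open>B\<close>, every cell lies
  in \<open>A \<union> S\<close> or in \<open>B \<union> S\<close>. Repeatedly absorb every vertex with at least \<open>k\<close>
  neighbours in what has been collected on one side: by maximality of the family the two resulting
  sets cover all vertices, so up to \<open>S\<close> the separation is determined by the choice of the cells on
  each side, and \<open>S\<close> covers all random edges between the two sets. If the smaller side comes from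
  \<open>j\<close> cells, this has probability at most \<open>(s/n)\<^sup>2\<^sup>j\<close>, small enough for a union bound
  over the choices of the cells.

  For (b), \<open>G\<^sub>0\<close> is a disjoint union of \<open>\<lfloor>n/(s+1)\<rfloor>\<close> cliques of almost equal size, namely
  the residue classes modulo that number, and an isolated clique is found by the second moment
  method.\<close>

subsection \<open>Highly connected subgraphs\<close>

definition non_adjacent :: "'a set set \<Rightarrow> 'a set \<Rightarrow> 'a set \<Rightarrow> bool" where
  "non_adjacent E A B \<longleftrightarrow> (\<forall>a\<in>A. \<forall>b\<in>B. {a, b} \<notin> E)"

text \<open>\<open>S\<close> need not lie in \<open>C\<close>, so a separator of the whole graph can
  be tested against \<open>C\<close> directly. Only resistance to cuts is recorded here; lower
  bounds on the size of \<open>C\<close> are stated separately.\<close>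

definition robustly_connected :: "'a set set \<Rightarrow> nat \<Rightarrow> 'a set \<Rightarrow> bool" where
  "robustly_connected E k C \<longleftrightarrow>
     (\<forall>S A B. finite S \<longrightarrow> card S < k \<longrightarrow> C - S = A \<union> B \<longrightarrow> A \<inter> B = {} \<longrightarrow>
        non_adjacent E A B \<longrightarrow> A = {} \<or> B = {})"

lemma non_adjacent_commute: "non_adjacent E A B \<longleftrightarrow> non_adjacent E B A"
  unfolding non_adjacent_def by (metis insert_commute)

section \<open>Edges, neighbours and degrees in simple graphs\<close>

lemma simple_graph_edgeE:
  assumes "simple_graph V E" "e \<in> E" "v \<in> e"
  obtains u where "e = {v, u}" "u \<noteq> v" "u \<in> V" "v \<in> V"
proof -
  have "e \<in> [V]\<^bsup>2\<^esup>" using assms by (auto simp: simple_graph_def)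
  then have *: "e \<subseteq> V" "card e = 2" by (auto simp: nsets_def)
  then obtain x y where xy: "e = {x, y}" "x \<noteq> y" by (meson card_2_iff)
  show thesis
    using that[of x] that[of y] xy * assms(3) by auto
qed

lemma simple_graph_edge_subset: "simple_graph V E \<Longrightarrow> e \<in> E \<Longrightarrow> e \<subseteq> V"
  and simple_graph_edge_card: "simple_graph V E \<Longrightarrow> e \<in> E \<Longrightarrow> card e = 2"
  unfolding simple_graph_def nsets_def by blast+

lemma simple_graph_finite: "simple_graph V E \<Longrightarrow> finite E"
  unfolding simple_graph_def using finite_imp_finite_nsets finite_subset by blast

lemma card_incident_edges:
  assumes "simple_graph V E" "z \<in> Z"
  shows "card {e \<in> E. e \<subseteq> Z \<and> z \<in> e} = card {u \<in> Z. {z, u} \<in> E}"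
proof -
  have "bij_betw (\<lambda>u. {z, u}) {u \<in> Z. {z, u} \<in> E} {e \<in> E. e \<subseteq> Z \<and> z \<in> e}"
    unfolding bij_betw_def
  proof
    show "inj_on (\<lambda>u. {z, u}) {u \<in> Z. {z, u} \<in> E}"
      by (auto simp: inj_on_def doubleton_eq_iff)
    show "(\<lambda>u. {z, u}) ` {u \<in> Z. {z, u} \<in> E} = {e \<in> E. e \<subseteq> Z \<and> z \<in> e}"
    proof (intro equalityI subsetI)
      fix e assume e: "e \<in> {e \<in> E. e \<subseteq> Z \<and> z \<in> e}"
      then obtain u where "e = {z, u}" using simple_graph_edgeE[OF assms(1)] by blast
      then show "e \<in> (\<lambda>u. {z, u}) ` {u \<in> Z. {z, u} \<in> E}" using e by auto
    qed (use assms in auto)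
  qed
  then show ?thesis by (rule bij_betw_same_card[symmetric])
qed

lemma degree_eq_card_neighbours:
  assumes "simple_graph V E" "v \<in> V"
  shows "degree E v = card {u \<in> V. {v, u} \<in> E}"
proof -
  have "{e \<in> E. v \<in> e} = {e \<in> E. e \<subseteq> V \<and> v \<in> e}"
    using simple_graph_edge_subset[OF assms(1)] by blast
  then show ?thesis
    using card_incident_edges[OF assms] by (simp add: degree_def)
qed

text \<open>Mader's theorem on highly connected subgraphs: the hypothesis on the number of edges is
  inherited by one of the two sides of any small separation.\<close>

lemma exists_robustly_connected_subset:
  fixes \<gamma> :: real
  assumes G: "simple_graph V E" and k: "k > 0" and \<gamma>: "\<gamma> \<ge> 2 * real k"
  assumes "X \<subseteq> V" "card X \<ge> 2 * k"
    and "real (card {e \<in> E. e \<subseteq> X}) > \<gamma> * (real (card X) - real k)"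
  shows "\<exists>C\<subseteq>X. robustly_connected E k C \<and> real (card C) > \<gamma>"
  using assms(4-)
proof (induction "card X" arbitrary: X rule: less_induct)
  case less
  have finV: "finite V" using G by (simp add: simple_graph_def)
  have finX: "finite X" using finV less.prems(1) finite_subset by blast
  have finE: "finite E" using simple_graph_finite[OF G] .
  show ?case
  proof (cases "\<exists>v\<in>X. real (card {e \<in> E. e \<subseteq> X \<and> v \<in> e}) \<le> \<gamma>")
    \<comment> \<open>Deleting a vertex of degree at most \<gamma> lowers the edge count by at most
      \<gamma> and the required bound by exactly \<gamma>, so the density hypothesis
      survives.\<close>
    case True
    then obtain v where v: "v \<in> X" "real (card {e \<in> E. e \<subseteq> X \<and> v \<in> e}) \<le> \<gamma>" by blast
    have "{e \<in> E. e \<subseteq> X} = {e \<in> E. e \<subseteq> X - {v}} \<union> {e \<in> E. e \<subseteq> X \<and> v \<in> e}" by auto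
    moreover have "card ({e \<in> E. e \<subseteq> X - {v}} \<union> {e \<in> E. e \<subseteq> X \<and> v \<in> e}) =
        card {e \<in> E. e \<subseteq> X - {v}} + card {e \<in> E. e \<subseteq> X \<and> v \<in> e}"
      by (rule card_Un_disjoint) (use finE in auto)
    ultimately have e: "card {e \<in> E. e \<subseteq> X} =
        card {e \<in> E. e \<subseteq> X - {v}} + card {e \<in> E. e \<subseteq> X \<and> v \<in> e}" by simp
    \<comment> \<open>On \<open>2 * k\<close> vertices the hypothesis would demand more than
      \<open>\<gamma> * k\<close>, hence more than \<open>2 * k * k\<close>, edges, but there are
      only \<open>k * (2 * k - 1)\<close> pairs. So removing a vertex respects the size
      hypothesis.\<close>
    have "card X \<noteq> 2 * k"
    proof
      assume c: "card X = 2 * k"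
      have "{e \<in> E. e \<subseteq> X} \<subseteq> [X]\<^bsup>2\<^esup>"
        using simple_graph_edge_card[OF G] finX finite_subset unfolding nsets_def by blast
      then have "card {e \<in> E. e \<subseteq> X} \<le> card ([X]\<^bsup>2\<^esup>)"
        using finX by (intro card_mono finite_imp_finite_nsets)
      also have "\<dots> = k * (2 * k - 1)" by (simp add: c choose_two)
      finally have "real (card {e \<in> E. e \<subseteq> X}) \<le> real (k * (2 * k - 1))" by linarith
      also have "\<dots> \<le> real k * (2 * real k)" unfolding of_nat_mult
        by (intro mult_left_mono) auto
      also have "\<dots> \<le> real k * \<gamma>" using \<gamma> by (intro mult_left_mono) auto
      finally show False using less.prems(3) c by (simp add: algebra_simps)
    qed
    then have big: "card (X - {v}) \<ge> 2 * k" using less.prems(2) v(1) finX by simp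
    have c1: "real (card (X - {v})) = real (card X) - 1"
      using v(1) finX by (metis One_nat_def Suc_pred card_Diff_singleton card_gt_0_iff empty_iff
          of_nat_1 of_nat_diff Suc_leI)
    have "card (X - {v}) < card X" using v(1) finX by (meson card_Diff1_less)
    moreover have "\<gamma> * (real (card (X - {v})) - real k) < real (card {e \<in> E. e \<subseteq> X - {v}})"
      using less.prems(3) e v(2) unfolding c1 by (simp add: algebra_simps)
    ultimately have "\<exists>C\<subseteq>X - {v}. robustly_connected E k C \<and> real (card C) > \<gamma>"
      using less.hyps[of "X - {v}"] less.prems(1) big by blast
    then show ?thesis by blast
  next
    case False
    then have deg: "real (card {e \<in> E. e \<subseteq> X \<and> v \<in> e}) > \<gamma>" if "v \<in> X" for v
      using that by force
    \<comment> \<open>All degrees inside \<open>X\<close> now exceed \<gamma>, so a set containing a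
      vertex and all its neighbours is large. For the sides \<open>Y\<close> and \<open>Z\<close>
      below this gives the size hypothesis, as \<open>\<gamma> \<ge> 2 * k\<close>.\<close>
    have card_gt: "real (card Y) > \<gamma>" if "v \<in> Y" "Y \<subseteq> X"
      "\<And>u. u \<in> X \<Longrightarrow> {v, u} \<in> E \<Longrightarrow> u \<in> Y" for v Y
    proof -
      have "card {e \<in> E. e \<subseteq> X \<and> v \<in> e} = card {u \<in> X. {v, u} \<in> E}"
        using card_incident_edges[OF G] that by blast
      also have "\<dots> \<le> card Y"
        using that finX by (intro card_mono) (auto intro: finite_subset)
      finally show ?thesis using deg[of v] that by auto
    qed
    have "X \<noteq> {}" using less.prems(2) k by auto
    then obtain v where "v \<in> X" by blast
    then have X_gt: "real (card X) > \<gamma>" using card_gt[of v X] by blast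
    show ?thesis
    proof (cases "robustly_connected E k X")
      case True
      then show ?thesis using X_gt by blast
    next
      case F: False
      then obtain S A B where S: "finite S" "card S < k" "X - S = A \<union> B" "A \<inter> B = {}"
          "non_adjacent E A B" "A \<noteq> {}" "B \<noteq> {}"
        unfolding robustly_connected_def by blast
      define Y where "Y = A \<union> (S \<inter> X)"
      define Z where "Z = B \<union> (S \<inter> X)"
      have sub: "Y \<subseteq> X" "Z \<subseteq> X" "Y \<union> Z = X" "Y \<inter> Z = S \<inter> X"
        using S(3,4) unfolding Y_def Z_def by auto
      have fin: "finite Y" "finite Z" using sub finX finite_subset by blast+
      have psub: "Y \<subset> X" "Z \<subset> X" using S(3,4,6,7) unfolding Y_def Z_def by blast+
      obtain a b where ab: "a \<in> A" "b \<in> B" using S by blast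
      have Yg: "real (card Y) > \<gamma>"
        by (rule card_gt[of a]) (use ab S sub in \<open>auto simp: Y_def non_adjacent_def\<close>)
      have Zg: "real (card Z) > \<gamma>"
        by (rule card_gt[of b])
          (use ab S sub in \<open>auto simp: Z_def non_adjacent_def insert_commute\<close>)
      have "card Y + card Z = card X + card (S \<inter> X)"
        using card_Un_Int[OF fin] sub by simp
      moreover have "card (S \<inter> X) \<le> card S" using S(1) by (intro card_mono) auto
      ultimately have YZ: "real (card Y) + real (card Z) \<le> real (card X) + real k"
        using S(2) by linarith
      have "{e \<in> E. e \<subseteq> X} \<subseteq> {e \<in> E. e \<subseteq> Y} \<union> {e \<in> E. e \<subseteq> Z}"
      proof
        fix e assume e: "e \<in> {e \<in> E. e \<subseteq> X}"
        then have "card e = 2" using simple_graph_edge_card[OF G] by blast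
        then obtain x y where xy: "e = {x, y}" by (meson card_2_iff)
        have "\<not> (x \<in> A \<and> y \<in> B)" "\<not> (x \<in> B \<and> y \<in> A)"
          using e xy S(5) by (auto simp: non_adjacent_def insert_commute)
        moreover have "x \<in> A \<union> B \<union> S" "y \<in> A \<union> B \<union> S" using e xy S(3) by auto
        ultimately show "e \<in> {e \<in> E. e \<subseteq> Y} \<union> {e \<in> E. e \<subseteq> Z}"
          using e xy S(3) unfolding Y_def Z_def by auto
      qed
      then have "card {e \<in> E. e \<subseteq> X} \<le> card ({e \<in> E. e \<subseteq> Y} \<union> {e \<in> E. e \<subseteq> Z})"
        using finE by (intro card_mono) auto
      also have "\<dots> \<le> card {e \<in> E. e \<subseteq> Y} + card {e \<in> E. e \<subseteq> Z}" by (rule card_Un_le)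
      finally have eYZ: "real (card {e \<in> E. e \<subseteq> X}) \<le>
          real (card {e \<in> E. e \<subseteq> Y}) + real (card {e \<in> E. e \<subseteq> Z})" by linarith
      \<comment> \<open>The sides share fewer than \<open>k\<close> vertices, so the bounds for
        \<open>Y\<close> and \<open>Z\<close> add up to at most the bound for \<open>X\<close>,
        while every edge within \<open>X\<close> lies within a side. Hence one side inherits the
        hypothesis.\<close>
      have "\<gamma> * (real (card Y) + real (card Z)) \<le> \<gamma> * (real (card X) + real k)"
        using YZ \<gamma> by (intro mult_left_mono) auto
      then consider "real (card {e \<in> E. e \<subseteq> Y}) > \<gamma> * (real (card Y) - real k)"
        | "real (card {e \<in> E. e \<subseteq> Z}) > \<gamma> * (real (card Z) - real k)"
        using eYZ less.prems(3) by (fastforce simp: algebra_simps)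
      then show ?thesis
      proof cases
        case 1
        have "\<exists>C\<subseteq>Y. robustly_connected E k C \<and> real (card C) > \<gamma>"
          by (rule less.hyps) (use 1 psub finX sub less.prems Yg \<gamma> in
              \<open>auto intro: psubset_card_mono\<close>)
        then show ?thesis using sub by blast
      next
        case 2
        have "\<exists>C\<subseteq>Z. robustly_connected E k C \<and> real (card C) > \<gamma>"
          by (rule less.hyps) (use 2 psub finX sub less.prems Zg \<gamma> in
              \<open>auto intro: psubset_card_mono\<close>)
        then show ?thesis using sub by blast
      qed
    qed
  qed
qed

text \<open>Handshaking gives at least \<open>d * card Z / 2\<close> edges inside \<open>Z\<close>,
  which is the density hypothesis for \<open>\<gamma> = d / 2\<close>; the condition
  \<open>4 * k \<le> d\<close> makes this \<gamma> at least \<open>2 * k\<close>.\<close>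

lemma exists_robustly_connected_subset_min_degree:
  assumes G: "simple_graph V E" and k: "k > 0" and d: "4 * k \<le> d"
  assumes Z: "Z \<subseteq> V" "Z \<noteq> {}" and deg: "\<And>z. z \<in> Z \<Longrightarrow> d \<le> card {u \<in> Z. {z, u} \<in> E}"
  shows "\<exists>C\<subseteq>Z. robustly_connected E k C \<and> 2 * card C > d"
proof -
  have finZ: "finite Z" using G Z finite_subset by (auto simp: simple_graph_def)
  have finE: "finite E" using simple_graph_finite[OF G] .
  have "(\<Sum>z\<in>Z. card {e \<in> {e \<in> E. e \<subseteq> Z}. z \<in> e}) = (\<Sum>e\<in>{e \<in> E. e \<subseteq> Z}. 2)"
  proof (rule sum_multicount_gen)
    show "\<forall>e\<in>{e \<in> E. e \<subseteq> Z}. card {z \<in> Z. z \<in> e} = 2"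
    proof
      fix e assume "e \<in> {e \<in> E. e \<subseteq> Z}"
      then have "card e = 2" "{z \<in> Z. z \<in> e} = e"
        using simple_graph_edge_card[OF G] by blast+
      then show "card {z \<in> Z. z \<in> e} = 2" by simp
    qed
  qed (use finZ finE in auto)
  moreover have "(\<Sum>z\<in>Z. card {e \<in> {e \<in> E. e \<subseteq> Z}. z \<in> e}) \<ge> (\<Sum>z\<in>Z. d)"
    using deg card_incident_edges[OF G] by (intro sum_mono) (simp add: conj_ac)
  ultimately have "d * card Z \<le> 2 * card {e \<in> E. e \<subseteq> Z}" by (simp add: mult.commute)
  then have "real (d * card Z) \<le> real (2 * card {e \<in> E. e \<subseteq> Z})" by (simp only: of_nat_le_iff)
  then have e: "real d / 2 * real (card Z) \<le> real (card {e \<in> E. e \<subseteq> Z})" by simp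
  obtain z where z: "z \<in> Z" using Z by blast
  have "card {u \<in> Z. {z, u} \<in> E} \<le> card Z" using finZ by (intro card_mono) auto
  then have cZ: "d \<le> card Z" using deg[OF z] by linarith
  have "real d / 2 * (real (card Z) - real k) < real d / 2 * real (card Z)"
    using k d by (intro mult_strict_left_mono) auto
  then have "\<exists>C\<subseteq>Z. robustly_connected E k C \<and> real (card C) > real d / 2"
    using e cZ d by (intro exists_robustly_connected_subset[OF G k _ Z(1)]) auto
  then show ?thesis by (auto simp: field_simps)
qed

subsection \<open>Separations and cells\<close>

definition separation :: "'a set \<Rightarrow> 'a set set \<Rightarrow> nat \<Rightarrow> 'a set \<Rightarrow> 'a set \<Rightarrow> 'a set \<Rightarrow> bool" where
  "separation V E k S A B \<longleftrightarrow>
     S \<subseteq> V \<and> card S < k \<and> V - S = A \<union> B \<and> A \<inter> B = {} \<and> A \<noteq> {} \<and> B \<noteq> {} \<and>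
     non_adjacent E A B"

lemma separation_commute: "separation V E k S A B \<longleftrightarrow> separation V E k S B A"
  unfolding separation_def using non_adjacent_commute by (metis Int_commute Un_commute)

text \<open>The iterative absorption is encoded as the least closed superset. It depends on
  \<open>E\<close>, \<open>k\<close> and \<open>U\<close> only, not on the random edges or the
  separator, so it can be fixed before any union bound.\<close>

definition absorption :: "'a set \<Rightarrow> 'a set set \<Rightarrow> nat \<Rightarrow> 'a set \<Rightarrow> 'a set" where
  "absorption V E k U =
     \<Inter>{Z. U \<subseteq> Z \<and> Z \<subseteq> V \<and> (\<forall>x\<in>V. k \<le> card {u \<in> Z. {x, u} \<in> E} \<longrightarrow> x \<in> Z)}"

lemma absorption_superset: "U \<subseteq> absorption V E k U"
  unfolding absorption_def by blast

lemma absorption_subset: "U \<subseteq> V \<Longrightarrow> absorption V E k U \<subseteq> V"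
  unfolding absorption_def by blast

text \<open>A vertex outside the closure is missed by some closed set \<open>Z\<close>, in which it
  has fewer than \<open>k\<close> neighbours, and \<open>Z\<close> contains the closure.\<close>

lemma absorption_closed:
  assumes "finite V" "U \<subseteq> V" "x \<in> V" "x \<notin> absorption V E k U"
  shows "card {u \<in> absorption V E k U. {x, u} \<in> E} < k"
proof -
  obtain Z where Z: "U \<subseteq> Z" "Z \<subseteq> V" "\<forall>x\<in>V. k \<le> card {u \<in> Z. {x, u} \<in> E} \<longrightarrow> x \<in> Z" "x \<notin> Z"
    using assms(4) unfolding absorption_def by blast
  have "absorption V E k U \<subseteq> Z" using Z unfolding absorption_def by blast
  then have "card {u \<in> absorption V E k U. {x, u} \<in> E} \<le> card {u \<in> Z. {x, u} \<in> E}"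
    using Z(2) assms(1) by (intro card_mono) (auto intro: finite_subset)
  also have "\<dots> < k" using Z assms(3) by fastforce
  finally show ?thesis .
qed

text \<open>The set \<open>A \<union> S\<close> is itself closed: a vertex outside it lies in
  \<open>B\<close>, and its neighbours in \<open>A \<union> S\<close> all belong to
  \<open>S\<close>, which has fewer than \<open>k\<close> elements.\<close>

lemma absorption_separation:
  assumes sep: "separation V E k S A B" and V: "finite V" and U: "U \<subseteq> A \<union> S"
  shows "absorption V E k U \<subseteq> A \<union> S"
proof -
  have S: "S \<subseteq> V" "card S < k" "V - S = A \<union> B" "A \<inter> B = {}" "non_adjacent E A B"
    using sep unfolding separation_def by auto
  have "x \<in> A \<union> S" if x: "x \<in> V" "k \<le> card {u \<in> A \<union> S. {x, u} \<in> E}" for x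
  proof (rule ccontr)
    assume "x \<notin> A \<union> S"
    then have "x \<in> B" using x(1) S(3) by blast
    then have "{u \<in> A \<union> S. {x, u} \<in> E} \<subseteq> S"
      using S(5) by (auto simp: non_adjacent_def insert_commute)
    then have "card {u \<in> A \<union> S. {x, u} \<in> E} \<le> card S"
      using S(1) V by (meson card_mono finite_subset)
    then show False using x(2) S(2) by linarith
  qed
  then show ?thesis using U S(1,3) unfolding absorption_def by blast
qed

text \<open>The order of quantifiers matters: the cells and the maps \<open>X\<close>,
  \<open>Y\<close> come from the fixed graph, and only the index set \<open>I\<close> depends on
  \<open>R\<close> and the separation. This replaces all separators by the subsets of a family of
  size \<open>O(n/s)\<close>.\<close>

lemma separation_reduces_to_cells:
  fixes V :: "'a set"
  assumes G: "simple_graph V E" and k: "k > 0" and s: "17 * k \<le> s"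
    and deg: "\<And>v. v \<in> V \<Longrightarrow> s \<le> card {u \<in> V. {v, u} \<in> E}"
  shows "\<exists>(\<C> :: 'a set set) X Y. finite \<C> \<and> card \<C> * (s - 2 * k) \<le> 2 * card V \<and>
    (\<forall>I\<subseteq>\<C>. X I \<subseteq> V \<and> Y I \<subseteq> V \<and> X I \<inter> Y I = {}) \<and>
    (\<forall>R S A B. separation V (E \<union> R) k S A B \<longrightarrow>
       (\<exists>I\<subseteq>\<C>. I \<noteq> {} \<and> card I * (s - 2 * k) \<le> 2 * (card (X I) + k) \<and> card V \<le> 2 * card (Y I) \<and>
          non_adjacent R (X I - S) (Y I - S)))"
proof -
  have V: "finite V" using G by (simp add: simple_graph_def)
  \<comment> \<open>A vertex with at most \<open>2 * k\<close> neighbours outside a set keeps at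
    least \<open>s - 2 * k\<close> inside; the density result then yields a robustly connected set
    of more than half that size.\<close>
  define cell where "cell C \<longleftrightarrow> robustly_connected E k C \<and> s - 2 * k < 2 * card C" for C
  define \<F> where "\<F> = {F. F \<subseteq> Pow V \<and> disjoint F \<and> (\<forall>C\<in>F. cell C)}"
  have "finite \<F>" "{} \<in> \<F>" unfolding \<F>_def using V by (auto simp: finite_subset[of _ "Pow (Pow V)"])
  then obtain \<C> where C: "\<C> \<in> \<F>" and maximal: "\<And>F. F \<in> \<F> \<Longrightarrow> \<C> \<subseteq> F \<Longrightarrow> F = \<C>"
    using finite_has_maximal[of \<F>] by blast
  have CV: "\<C> \<subseteq> Pow V" and disj: "disjoint \<C>" and cells: "\<And>C. C \<in> \<C> \<Longrightarrow> cell C"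
    using C unfolding \<F>_def by auto
  have finC: "finite \<C>" using CV V by (simp add: finite_subset)
  have card_Union: "card I * (s - 2 * k) \<le> 2 * card (\<Union>I)" if I: "I \<subseteq> \<C>" for I
  proof -
    have "card (\<Union>I) = sum card I"
      using I disj CV V by (intro card_Union_disjoint)
        (auto intro: finite_subset simp: pairwise_subset)
    moreover have "(\<Sum>C\<in>I. s - 2 * k) \<le> (\<Sum>C\<in>I. 2 * card C)"
      using cells I by (intro sum_mono) (force simp: cell_def)
    ultimately show ?thesis by (simp add: sum_distrib_left)
  qed
  \<comment> \<open>Such a \<open>Z\<close> would have internal minimum degree at least
    \<open>s - 2 * k\<close>, which is at least \<open>4 * k\<close> because
    \<open>17 * k \<le> s\<close>. It would contain a further cell, against maximality of the
    family.\<close>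
  have no_cell: False
    if Z: "Z \<subseteq> V" "Z \<noteq> {}" "Z \<inter> \<Union>\<C> = {}" and out: "\<And>z. z \<in> Z \<Longrightarrow> card {u \<in> V - Z. {z, u} \<in> E} \<le> 2 * k"
    for Z
  proof -
    have "s - 2 * k \<le> card {u \<in> Z. {z, u} \<in> E}" if z: "z \<in> Z" for z
    proof -
      have "{u \<in> V. {z, u} \<in> E} = {u \<in> Z. {z, u} \<in> E} \<union> {u \<in> V - Z. {z, u} \<in> E}"
        using Z by auto
      then have "card {u \<in> V. {z, u} \<in> E} \<le> card {u \<in> Z. {z, u} \<in> E} + card {u \<in> V - Z. {z, u} \<in> E}"
        by (simp only: card_Un_le)
      moreover have "s \<le> card {u \<in> V. {z, u} \<in> E}" using deg z Z(1) by blast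
      ultimately show ?thesis using out[OF z] by linarith
    qed
    then obtain C where C': "C \<subseteq> Z" "cell C"
      using exists_robustly_connected_subset_min_degree[OF G k _ Z(1,2), of "s - 2 * k"] s
      unfolding cell_def by force
    have "C \<noteq> {}" using C'(2) by (auto simp: cell_def)
    then have "C \<notin> \<C>" using C' Z(3) by blast
    moreover have "insert C \<C> \<in> \<F>"
      using C' Z CV disj cells unfolding \<F>_def by (auto simp: pairwise_insert disjnt_def)
    ultimately show False using maximal[of "insert C \<C>"] by blast
  qed
  \<comment> \<open>The overlap of the two closures is removed from \<open>X I\<close> only. Thus
    \<open>Y I\<close> keeps at least half of the vertices when it is the larger closure, and
    \<open>X I\<close> loses at most \<open>k\<close> vertices.\<close>
  define Y where "Y I = absorption V E k (\<Union>(\<C> - I))" for I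
  define X where "X I = absorption V E k (\<Union>I) - Y I" for I
  have "\<exists>I\<subseteq>\<C>. I \<noteq> {} \<and> card I * (s - 2 * k) \<le> 2 * (card (X I) + k) \<and> card V \<le> 2 * card (Y I) \<and>
          non_adjacent R (X I - S) (Y I - S)"
    if sep: "separation V (E \<union> R) k S A B" for R S A B
  proof -
    have sepE: "separation V E k S A B" and RAB: "non_adjacent R A B"
      using sep unfolding separation_def non_adjacent_def by auto
    have S: "S \<subseteq> V" "card S < k" "V - S = A \<union> B" "A \<inter> B = {}" "A \<noteq> {}" "B \<noteq> {}"
      "non_adjacent E A B"
      using sepE unfolding separation_def by auto
    have finS: "finite S" using S(1) V finite_subset by blast
    \<comment> \<open>The separator has fewer than \<open>k\<close> vertices and cannot split a
      cell, so a cell that is not within \<open>A \<union> S\<close> is within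
      \<open>B \<union> S\<close>.\<close>
    have side: "\<Union>{C\<in>\<C>. C \<subseteq> A \<union> S} \<subseteq> A \<union> S" "\<Union>(\<C> - {C\<in>\<C>. C \<subseteq> A \<union> S}) \<subseteq> B \<union> S"
    proof -
      have "C \<subseteq> B \<union> S" if "C \<in> \<C>" "\<not> C \<subseteq> A \<union> S" for C
      proof -
        have "C - S = (C \<inter> A) \<union> (C \<inter> B)" "(C \<inter> A) \<inter> (C \<inter> B) = {}"
          using that(1) CV S(3,4) by auto
        moreover have "non_adjacent E (C \<inter> A) (C \<inter> B)"
          using S(7) unfolding non_adjacent_def by auto
        ultimately have "C \<inter> A = {} \<or> C \<inter> B = {}"
          using cells[OF that(1)] finS S(2) unfolding cell_def robustly_connected_def by blast
        then show ?thesis using that CV S(3) by blast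
      qed
      then show "\<Union>(\<C> - {C\<in>\<C>. C \<subseteq> A \<union> S}) \<subseteq> B \<union> S" by blast
    qed auto
    have few: "card {u \<in> V - A. {z, u} \<in> E} \<le> 2 * k" if "separation V E k S A B" "z \<in> A" for z A B
    proof -
      have "{u \<in> V - A. {z, u} \<in> E} \<subseteq> S"
        using that unfolding separation_def non_adjacent_def by auto
      then have "card {u \<in> V - A. {z, u} \<in> E} \<le> card S" using finS by (rule card_mono[rotated])
      then show ?thesis using S(2) by linarith
    qed
    define I where "I = {C\<in>\<C>. C \<subseteq> A \<union> S}"
    define J where "J = \<C> - I"
    have IJ: "I \<subseteq> \<C>" "J \<subseteq> \<C>" "\<C> - J = I" "\<C> - I = J" unfolding I_def J_def by auto
    have UI: "\<Union>I \<subseteq> A \<union> S" and UJ: "\<Union>J \<subseteq> B \<union> S" using side unfolding I_def J_def by auto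
    \<comment> \<open>If all cells were on one side, the other side would be free of cells, with all
      outward neighbours in \<open>S\<close>, contradicting \<open>no_cell\<close>.\<close>
    have ne: "I \<noteq> {}" "J \<noteq> {}"
    proof -
      have AB: "A \<subseteq> V" "B \<subseteq> V" "A \<inter> S = {}" "B \<inter> S = {}" using S(3) by auto
      show "I \<noteq> {}"
      proof
        assume "I = {}"
        then have "\<Union>\<C> \<subseteq> B \<union> S" using UJ IJ by auto
        then have "A \<inter> \<Union>\<C> = {}" using AB S(4) by blast
        then show False using no_cell[of A] few[OF sepE] AB(1) S(5) by blast
      qed
      show "J \<noteq> {}"
      proof
        assume "J = {}"
        then have "\<Union>\<C> \<subseteq> A \<union> S" using UI IJ by auto
        then have "B \<inter> \<Union>\<C> = {}" using AB S(4) by blast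
        then show False
          using no_cell[of B] few[of B A] sepE separation_commute AB(2) S(6) by blast
      qed
    qed
    define P where "P = absorption V E k (\<Union>I)"
    define Q where "Q = absorption V E k (\<Union>J)"
    have UIP: "\<Union>I \<subseteq> P" and UJQ: "\<Union>J \<subseteq> Q"
      unfolding P_def Q_def by (rule absorption_superset)+
    have UV: "\<Union>I \<subseteq> V" "\<Union>J \<subseteq> V" using IJ CV by auto
    have PQV: "P \<subseteq> V" "Q \<subseteq> V" unfolding P_def Q_def using UV absorption_subset by blast+
    have fin: "finite P" "finite Q" using PQV V finite_subset by blast+
    have PS: "P \<subseteq> A \<union> S" unfolding P_def by (rule absorption_separation[OF sepE V UI])
    have QS: "Q \<subseteq> B \<union> S" unfolding Q_def
      using absorption_separation[OF _ V UJ] sepE separation_commute by blast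
    \<comment> \<open>Vertices outside both closures have fewer than \<open>k\<close> neighbours in
      each, so at most \<open>2 * k\<close> outside the uncovered set. This is the source of the
      allowance \<open>2 * k\<close>.\<close>
    have cover: "P \<union> Q = V"
    proof (rule ccontr)
      assume "P \<union> Q \<noteq> V"
      then have "V - (P \<union> Q) \<noteq> {}" using PQV by blast
      moreover have "\<Union>\<C> \<subseteq> P \<union> Q"
      proof -
        have "\<C> = I \<union> J" using IJ(1) unfolding J_def by blast
        then show ?thesis using UIP UJQ by blast
      qed
      moreover have "card {u \<in> V - (V - (P \<union> Q)). {z, u} \<in> E} \<le> 2 * k" if z: "z \<in> V - (P \<union> Q)" for z
      proof -
        have "{u \<in> V - (V - (P \<union> Q)). {z, u} \<in> E} = {u \<in> P. {z, u} \<in> E} \<union> {u \<in> Q. {z, u} \<in> E}"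
          using PQV by auto
        then have "card {u \<in> V - (V - (P \<union> Q)). {z, u} \<in> E} \<le>
            card {u \<in> P. {z, u} \<in> E} + card {u \<in> Q. {z, u} \<in> E}"
          by (simp only: card_Un_le)
        moreover have "card {u \<in> P. {z, u} \<in> E} < k" "card {u \<in> Q. {z, u} \<in> E} < k"
          using z absorption_closed[OF V UV(1)] absorption_closed[OF V UV(2)]
          unfolding P_def Q_def by blast+
        ultimately show ?thesis
          by linarith
      qed
      ultimately show False using no_cell[of "V - (P \<union> Q)"] by blast
    qed
    have PQ: "card (P \<inter> Q) \<le> k"
    proof -
      have "P \<inter> Q \<subseteq> S" using PS QS S(4) by blast
      then have "card (P \<inter> Q) \<le> card S" using finS by (rule card_mono[rotated])
      then show ?thesis using S(2) by linarith
    qed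
    have cV: "card V \<le> card P + card Q" using card_Un_le[of P Q] cover by simp
    have cP: "card P \<le> card (P - Q) + k" and cQ: "card Q \<le> card (Q - P) + k"
      using PQ card_Diff_subset_Int[of P Q] card_Diff_subset_Int[of Q P] fin
      by (simp_all add: Int_commute)
    have PI: "card (\<Union>I) \<le> card P" and QJ: "card (\<Union>J) \<le> card Q"
      using UIP UJQ fin by (simp_all add: card_mono)
    have sub: "P - S \<subseteq> A" "Q - S \<subseteq> B" using PS QS by auto
    show ?thesis
    \<comment> \<open>The smaller closure takes the role of \<open>X\<close>, so the larger one
      covers at least half of \<open>V\<close>. The index is accordingly \<open>I\<close> or the
      complementary family \<open>J\<close>.\<close>
    proof (cases "card P \<le> card Q")
      case True
      have XY: "X I = P - Q" "Y I = Q" unfolding X_def Y_def P_def Q_def IJ by auto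
      have "non_adjacent R (P - Q - S) (Q - S)"
        using RAB sub unfolding non_adjacent_def by blast
      then show ?thesis
        using True IJ(1) ne(1) XY card_Union[OF IJ(1)] PI cP cV by (intro exI[of _ I]) auto
    next
      case False
      have XY: "X J = Q - P" "Y J = P" unfolding X_def Y_def P_def Q_def IJ by auto
      have "non_adjacent R (Q - P - S) (P - S)"
        using RAB[unfolded non_adjacent_commute[of R A]] sub unfolding non_adjacent_def by blast
      then show ?thesis
        using False IJ(2) ne(2) XY card_Union[OF IJ(2)] QJ cQ cV by (intro exI[of _ J]) auto
    qed
  qed
  moreover have "X I \<subseteq> V \<and> Y I \<subseteq> V \<and> X I \<inter> Y I = {}" if "I \<subseteq> \<C>" for I
  proof -
    have "\<Union>I \<subseteq> V" "\<Union>(\<C> - I) \<subseteq> V" using that CV by auto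
    then show ?thesis unfolding X_def Y_def using absorption_subset by blast
  qed
  moreover have "card \<C> * (s - 2 * k) \<le> 2 * card V"
  proof -
    have "card (\<Union>\<C>) \<le> card V" using CV V by (intro card_mono) auto
    then show ?thesis using card_Union[OF subset_refl] by linarith
  qed
  ultimately show ?thesis
    using finC by blast
qed

subsection \<open>Small covers of random bipartite graphs\<close>

lemma prob_binomial_random_graph:
  assumes "M \<subseteq> [{..<n}]\<^bsup>2\<^esup>" "F \<subseteq> [{..<n}]\<^bsup>2\<^esup>" "M \<inter> F = {}" "0 \<le> p" "p \<le> 1"
  shows "measure_pmf.prob (binomial_random_graph n p) {R. M \<subseteq> R \<and> R \<inter> F = {}} =
    p ^ card M * (1 - p) ^ card F"
proof -
  let ?A = "[{..<n}]\<^bsup>2\<^esup>"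
  have finA: "finite ?A" by (simp add: finite_imp_finite_nsets)
  then have fin: "finite M" "finite F" using assms finite_subset by blast+
  \<comment> \<open>Each pair is forced present, forced absent or left free, so the event is a
    product set and its probability factorises.\<close>
  define B where "B e = (if e \<in> M then {True} else if e \<in> F then {False} else UNIV)" for e
  have "(\<lambda>f. {e \<in> ?A. f e}) -` {R. M \<subseteq> R \<and> R \<inter> F = {}} = Pi ?A B"
    using assms(1-3) unfolding B_def Pi_def by (auto split: if_splits)
  then have "measure_pmf.prob (binomial_random_graph n p) {R. M \<subseteq> R \<and> R \<inter> F = {}} =
      measure_pmf.prob (Pi_pmf ?A False (\<lambda>_. bernoulli_pmf p)) (Pi ?A B)"
    by (simp add: binomial_random_graph_def)
  also have "\<dots> = (\<Prod>e\<in>?A. measure_pmf.prob (bernoulli_pmf p) (B e))"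
    by (rule measure_Pi_pmf_Pi[OF finA])
  also have "\<dots> = (\<Prod>e\<in>?A. (if e \<in> M then p else 1) * (if e \<in> F then 1 - p else 1))"
    using assms by (intro prod.cong) (auto simp: B_def measure_pmf_single)
  also have "\<dots> = (\<Prod>e\<in>?A \<inter> M. p) * (\<Prod>e\<in>?A \<inter> F. 1 - p)"
    by (simp only: prod.distrib prod.inter_restrict[OF finA])
  also have "\<dots> = p ^ card M * (1 - p) ^ card F"
    using assms(1,2) by (simp add: Int_absorb1)
  finally show ?thesis .
qed

section \<open>Pairs between two disjoint sets, and matchings among them\<close>

definition cross_pairs :: "'a set \<Rightarrow> 'a set \<Rightarrow> 'a set set" where
  "cross_pairs X Y = (\<lambda>(x, y). {x, y}) ` (X \<times> Y)"

lemma cross_pairs_iff: "e \<in> cross_pairs X Y \<longleftrightarrow> (\<exists>x\<in>X. \<exists>y\<in>Y. e = {x, y})"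
  by (auto simp: cross_pairs_def)

lemma finite_cross_pairs: "finite X \<Longrightarrow> finite Y \<Longrightarrow> finite (cross_pairs X Y)"
  by (simp add: cross_pairs_def)

lemma card_cross_pairs:
  assumes "X \<inter> Y = {}"
  shows "card (cross_pairs X Y) = card X * card Y"
proof -
  have "inj_on (\<lambda>(x, y). {x, y}) (X \<times> Y)"
    using assms by (auto simp: inj_on_def doubleton_eq_iff)
  then show ?thesis by (simp add: cross_pairs_def card_image card_cartesian_product)
qed

lemma cross_pairs_subset_nsets:
  "X \<subseteq> V \<Longrightarrow> Y \<subseteq> V \<Longrightarrow> X \<inter> Y = {} \<Longrightarrow> cross_pairs X Y \<subseteq> [V]\<^bsup>2\<^esup>"
  by (auto simp: cross_pairs_def doubleton_in_nsets_2)

lemma cross_pairs_commute: "cross_pairs X Y = cross_pairs Y X"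
proof -
  have "cross_pairs A B \<subseteq> cross_pairs B A" for A B :: "'a set"
  proof
    fix e assume "e \<in> cross_pairs A B"
    then obtain x y where "x \<in> A" "y \<in> B" "e = {x, y}" unfolding cross_pairs_iff by blast
    moreover have "{x, y} = {y, x}" by blast
    ultimately show "e \<in> cross_pairs B A" unfolding cross_pairs_iff by blast
  qed
  then show ?thesis by blast
qed

text \<open>Each pair in \<open>M\<close> has exactly one endpoint in \<open>X\<close>.\<close>

lemma card_Int_Union_cross_pairs:
  assumes M: "M \<subseteq> cross_pairs X Y" "finite M" and "X \<inter> Y = {}"
  shows "card (X \<inter> \<Union>M) \<le> card M"
proof -
  have "card (e \<inter> X) \<le> 1" if "e \<in> M" for e
  proof -
    have "e \<in> cross_pairs X Y" using that M(1) by blast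
    then obtain x y where "e = {x, y}" "x \<in> X" "y \<in> Y" unfolding cross_pairs_iff by blast
    then have "e \<inter> X = {x}" using assms(3) by auto
    then show ?thesis by simp
  qed
  then have "(\<Sum>e\<in>M. card (e \<inter> X)) \<le> (\<Sum>e\<in>M. 1)" by (intro sum_mono) auto
  moreover have "X \<inter> \<Union>M = (\<Union>e\<in>M. e \<inter> X)" by blast
  then have "card (X \<inter> \<Union>M) \<le> (\<Sum>e\<in>M. card (e \<inter> X))" using card_UN_le[OF M(2)] by metis
  ultimately show ?thesis by simp
qed

lemma sum_power_card_Pow:
  fixes x :: "'b :: comm_semiring_1"
  assumes "finite A"
  shows "(\<Sum>M\<in>Pow A. x ^ card M) = (1 + x) ^ card A"
  using prod_add[OF assms, of "\<lambda>_. x" "\<lambda>_. 1"] by (simp add: add.commute)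

text \<open>\<open>M\<close> is a maximal matching in \<open>R\<close> between \<open>X\<close> and
  \<open>Y\<close>. Every edge of it meets \<open>S\<close>, and disjointness makes the chosen
  vertices of \<open>S\<close> distinct; by maximality no edge of \<open>R\<close> avoids the
  matched vertices.\<close>

lemma exists_maximal_matching_of_cover:
  assumes fin: "finite X" "finite Y" and "X \<inter> Y = {}"
    and S: "finite S" "non_adjacent R (X - S) (Y - S)"
  shows "\<exists>M\<subseteq>R \<inter> cross_pairs X Y.
    card M \<le> card S \<and> R \<inter> cross_pairs (X - \<Union>M) (Y - \<Union>M) = {}"
proof -
  define \<M> where "\<M> = {M. M \<subseteq> R \<inter> cross_pairs X Y \<and> disjoint M}"
  have "finite \<M>" unfolding \<M>_def
    by (rule finite_subset[of _ "Pow (cross_pairs X Y)"]) (use fin in \<open>auto simp: finite_cross_pairs\<close>)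
  moreover have "{} \<in> \<M>" unfolding \<M>_def by simp
  ultimately obtain M where M: "M \<in> \<M>" and maximal: "\<And>M'. M' \<in> \<M> \<Longrightarrow> M \<subseteq> M' \<Longrightarrow> M' = M"
    using finite_has_maximal[of \<M>] by blast
  have sub: "M \<subseteq> R \<inter> cross_pairs X Y" and disj: "disjoint M" using M unfolding \<M>_def by auto
  have "\<exists>v. v \<in> e \<inter> S" if "e \<in> M" for e
  proof -
    have e: "e \<in> R" "e \<in> cross_pairs X Y" using that sub by auto
    then obtain x y where xy: "e = {x, y}" "x \<in> X" "y \<in> Y" unfolding cross_pairs_iff by blast
    then have "x \<in> S \<or> y \<in> S" using S(2) e(1) by (auto simp: non_adjacent_def)
    then show ?thesis using xy by auto
  qed
  then obtain f where f: "\<And>e. e \<in> M \<Longrightarrow> f e \<in> e \<inter> S" by metis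
  have "inj_on f M"
  proof (rule inj_onI)
    fix e e' assume e: "e \<in> M" "e' \<in> M" "f e = f e'"
    then have "f e \<in> e \<inter> e'" using f by (metis IntD1 IntI)
    then show "e = e'" using disj e unfolding pairwise_def disjnt_def by blast
  qed
  moreover have "f ` M \<subseteq> S" using f by blast
  ultimately have "card M \<le> card S" using S(1) by (rule card_inj_on_le)
  moreover have "e \<notin> cross_pairs (X - \<Union>M) (Y - \<Union>M)" if "e \<in> R" for e
  proof
    assume e: "e \<in> cross_pairs (X - \<Union>M) (Y - \<Union>M)"
    then have "e \<in> cross_pairs X Y" "e \<inter> \<Union>M = {}" "e \<noteq> {}"
      unfolding cross_pairs_iff by blast+
    then have "e \<notin> M" "\<And>e'. e' \<in> M \<Longrightarrow> disjnt e e' \<and> disjnt e' e"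
      unfolding disjnt_def by blast+
    moreover from this have "disjoint (insert e M)" using disj by (simp add: pairwise_insert)
    ultimately have "insert e M \<in> \<M>" "e \<notin> M"
      using sub that \<open>e \<in> cross_pairs X Y\<close> unfolding \<M>_def by blast+
    then show False using maximal[of "insert e M"] by blast
  qed
  ultimately show ?thesis using sub by blast
qed

text \<open>A union bound over the covers \<open>S\<close> themselves would be too lossy: there are more of them
  than the probability of a single one can pay for. Summing over maximal matchings \<open>M\<close> instead
  keeps the factor \<open>p ^ card M\<close>, which compensates the number of choices.\<close>

lemma prob_small_cover_le:
  assumes XY: "X \<subseteq> {..<n}" "Y \<subseteq> {..<n}" "X \<inter> Y = {}" and k: "k \<le> card X" "k \<le> card Y"
    and p: "0 \<le> p" "p \<le> 1"
  shows "measure_pmf.prob (binomial_random_graph n p)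
      {R. \<exists>S. finite S \<and> card S < k \<and> non_adjacent R (X - S) (Y - S)}
    \<le> 8 ^ k * exp (p * (card X * card Y) / 8 - p * ((card X - k) * (card Y - k)))"
proof -
  let ?P = "measure_pmf.prob (binomial_random_graph n p)"
  have fin: "finite X" "finite Y" using XY finite_subset by blast+
  let ?F = "\<lambda>M. cross_pairs (X - \<Union>M) (Y - \<Union>M)"
  let ?q = "exp (- (p * ((card X - k) * (card Y - k))))"
  define \<M> where "\<M> = {M. M \<subseteq> cross_pairs X Y \<and> card M < k}"
  have finM: "finite \<M>" unfolding \<M>_def
    by (rule finite_subset[of _ "Pow (cross_pairs X Y)"]) (use fin in \<open>auto simp: finite_cross_pairs\<close>)
  have "{R. \<exists>S. finite S \<and> card S < k \<and> non_adjacent R (X - S) (Y - S)}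
      \<subseteq> (\<Union>M\<in>\<M>. {R. M \<subseteq> R \<and> R \<inter> ?F M = {}})"
  proof clarify
    fix R S assume S: "finite S" "card S < k" "non_adjacent R (X - S) (Y - S)"
    obtain M where M: "M \<subseteq> R \<inter> cross_pairs X Y" "card M \<le> card S" "R \<inter> ?F M = {}"
      using exists_maximal_matching_of_cover[OF fin XY(3) S(1,3)] by blast
    then have "M \<in> \<M>" using S(2) unfolding \<M>_def by simp
    then show "R \<in> (\<Union>M\<in>\<M>. {R. M \<subseteq> R \<and> R \<inter> ?F M = {}})"
      using M by blast
  qed
  then have "?P {R. \<exists>S. finite S \<and> card S < k \<and> non_adjacent R (X - S) (Y - S)}
      \<le> ?P (\<Union>M\<in>\<M>. {R. M \<subseteq> R \<and> R \<inter> ?F M = {}})"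
    by (intro measure_pmf.finite_measure_mono) auto
  also have "\<dots> \<le> (\<Sum>M\<in>\<M>. ?P {R. M \<subseteq> R \<and> R \<inter> ?F M = {}})"
    using finM by (intro measure_pmf.finite_measure_subadditive_finite) auto
  also have "\<dots> \<le> (\<Sum>M\<in>\<M>. 8 ^ k * (p / 8) ^ card M * ?q)"
  proof (rule sum_mono)
    fix M assume "M \<in> \<M>"
    then have M: "M \<subseteq> cross_pairs X Y" "card M < k" by (auto simp: \<M>_def)
    have finM': "finite M" using M(1) fin finite_cross_pairs finite_subset by blast
    have "card (X \<inter> \<Union>M) \<le> card M" "card (Y \<inter> \<Union>M) \<le> card M"
      using card_Int_Union_cross_pairs[of M X Y] card_Int_Union_cross_pairs[of M Y X] M(1) finM' XY(3)
      by (auto simp: cross_pairs_commute[of Y X])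
    then have "card (X \<inter> \<Union>M) \<le> k" "card (Y \<inter> \<Union>M) \<le> k" using M(2) by linarith+
    then have "card X - k \<le> card (X - \<Union>M)" "card Y - k \<le> card (Y - \<Union>M)"
      using fin by (auto simp: card_Diff_subset_Int)
    then have "(card X - k) * (card Y - k) \<le> card (X - \<Union>M) * card (Y - \<Union>M)"
      by (rule mult_le_mono)
    also have "\<dots> = card (?F M)" using XY(3) by (intro card_cross_pairs[symmetric]) auto
    finally have F: "(card X - k) * (card Y - k) \<le> card (?F M)" .
    have "(1 - p) ^ card (?F M) \<le> exp (- p) ^ card (?F M)"
      using exp_ge_add_one_self[of "- p"] p by (intro power_mono) auto
    also have "\<dots> = exp (- (p * card (?F M)))"
      by (simp add: exp_of_nat_mult[symmetric] mult.commute)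
    also have "\<dots> \<le> ?q" using F p by (auto intro!: mult_left_mono simp del: of_nat_mult)
    finally have q: "(1 - p) ^ card (?F M) \<le> ?q" .
    have "?P {R. M \<subseteq> R \<and> R \<inter> ?F M = {}} = p ^ card M * (1 - p) ^ card (?F M)"
    proof (rule prob_binomial_random_graph)
      show "M \<subseteq> [{..<n}]\<^bsup>2\<^esup>" using M(1) cross_pairs_subset_nsets[OF XY] by blast
      show "?F M \<subseteq> [{..<n}]\<^bsup>2\<^esup>" using XY by (intro cross_pairs_subset_nsets) auto
      show "M \<inter> ?F M = {}" by (auto simp: cross_pairs_iff)
    qed (use p in auto)
    also have "\<dots> \<le> p ^ card M * ?q" using q p by (intro mult_left_mono) auto
    \<comment> \<open>Trading a factor \<open>8 ^ k\<close> for the weights \<open>p / 8\<close>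
      makes the sum over all sets of pairs at most \<open>exp (p * card X * card Y / 8)\<close>, a
      small part of the exponent gained from the absent edges.\<close>
    also have "p ^ card M \<le> 8 ^ k * (p / 8) ^ card M"
    proof -
      have "p ^ card M = 8 ^ card M * (p / 8) ^ card M" by (simp add: power_mult_distrib[symmetric])
      also have "\<dots> \<le> 8 ^ k * (p / 8) ^ card M"
        using M(2) p by (intro mult_right_mono power_increasing) auto
      finally show ?thesis .
    qed
    finally show "?P {R. M \<subseteq> R \<and> R \<inter> ?F M = {}} \<le> 8 ^ k * (p / 8) ^ card M * ?q"
      by (simp add: mult_right_mono)
  qed
  also have "\<dots> = 8 ^ k * ?q * (\<Sum>M\<in>\<M>. (p / 8) ^ card M)"
    unfolding sum_distrib_left by (intro sum.cong) simp_all
  also have "\<dots> \<le> 8 ^ k * ?q * (\<Sum>M\<in>Pow (cross_pairs X Y). (p / 8) ^ card M)"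
    using p fin by (intro mult_left_mono sum_mono2) (auto simp: \<M>_def finite_cross_pairs)
  also have "\<dots> = 8 ^ k * ?q * (1 + p / 8) ^ (card X * card Y)"
    by (subst sum_power_card_Pow)
      (use fin XY(3) in \<open>simp_all add: finite_cross_pairs card_cross_pairs\<close>)
  also have "\<dots> \<le> 8 ^ k * ?q * exp (p / 8) ^ (card X * card Y)"
    using exp_ge_add_one_self[of "p / 8"] p by (intro mult_left_mono power_mono) auto
  also have "exp (p / 8) ^ (card X * card Y) = exp (p * (card X * card Y) / 8)"
    by (simp add: exp_of_nat_mult[symmetric] mult.commute)
  finally show ?thesis
    by (simp only: diff_conv_add_uminus exp_add of_nat_mult mult_ac)
qed

subsection \<open>Connectivity of the perturbed graph\<close>

lemma not_connected_graphE:
  assumes "\<not> connected_graph W {e \<in> E. e \<subseteq> W}"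
  obtains A B where "W = A \<union> B" "A \<inter> B = {}" "A \<noteq> {}" "B \<noteq> {}" "non_adjacent E A B"
proof -
  let ?r = "{(x, y). x \<in> W \<and> y \<in> W \<and> {x, y} \<in> {e \<in> E. e \<subseteq> W}}"
  obtain u v where uv: "u \<in> W" "v \<in> W" "(u, v) \<notin> ?r\<^sup>*"
    using assms unfolding connected_graph_def by blast
  define A where "A = {x \<in> W. (u, x) \<in> ?r\<^sup>*}"
  have "{a, b} \<notin> E" if "a \<in> A" "b \<in> W - A" for a b
  proof
    assume "{a, b} \<in> E"
    then have "(a, b) \<in> ?r" using that unfolding A_def by auto
    then have "(u, b) \<in> ?r\<^sup>*" using that unfolding A_def by (blast intro: rtrancl_into_rtrancl)
    then show False using that unfolding A_def by blast
  qed
  then have "non_adjacent E A (W - A)" unfolding non_adjacent_def by blast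
  moreover have "u \<in> A" "v \<in> W - A" using uv unfolding A_def by auto
  ultimately show thesis using that[of A "W - A"] unfolding A_def by blast
qed

text \<open>Since \<open>k < card V\<close>, deleting fewer than \<open>k\<close> vertices leaves at
  least two, which rules out the degenerate alternative in the definition of connectivity.\<close>

lemma vertex_connectivity_geI:
  assumes V: "finite V" "k < card V" and "\<And>S A B. \<not> separation V E k S A B"
  shows "k \<le> vertex_connectivity V E"
proof -
  let ?Q = "\<lambda>m. \<exists>S\<subseteq>V. card S = m \<and>
    (\<not> connected_graph (V - S) {e \<in> E. e \<subseteq> V - S} \<or> card (V - S) \<le> 1)"
  \<comment> \<open>Deleting all vertices is admissible, so the least number is attained.\<close>
  have "?Q (card V)" by (intro exI[of _ V]) auto
  then have "?Q (vertex_connectivity V E)" unfolding vertex_connectivity_def by (rule LeastI)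
  then obtain S where S: "S \<subseteq> V" "card S = vertex_connectivity V E"
    "\<not> connected_graph (V - S) {e \<in> E. e \<subseteq> V - S} \<or> card (V - S) \<le> 1" by blast
  show ?thesis
  proof (rule ccontr)
    assume "\<not> ?thesis"
    then have less: "card S < k" using S(2) by simp
    moreover have "card (V - S) = card V - card S"
      using S(1) V(1) by (simp add: card_Diff_subset finite_subset)
    ultimately have "\<not> connected_graph (V - S) {e \<in> E. e \<subseteq> V - S}" using S(3) V(2) by linarith
    then obtain A B where "V - S = A \<union> B" "A \<inter> B = {}" "A \<noteq> {}" "B \<noteq> {}" "non_adjacent E A B"
      by (rule not_connected_graphE)
    then have "separation V E k S A B" using S(1) less unfolding separation_def by blast
    then show False using assms(3) by blast
  qed
qed

text \<open>Here \<open>j\<close> is the number of cells, \<open>x\<close> and \<open>y\<close> are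
  the sizes of the two sides, and \<open>L\<close> stands for \<open>ln (n / s)\<close>. The term
  \<open>3 * k\<close> pays for the factor \<open>8 ^ k\<close>; the conclusion corresponds to
  probability at most \<open>(s/n)\<close> to the power \<open>2 * j\<close>.\<close>

lemma small_cover_exponent_le:
  fixes x y k s n j p L :: real
  assumes k: "1 \<le> k" "17 * k \<le> s" "s \<le> n" and j: "1 \<le> j"
    and x: "j * (s - 2 * k) \<le> 2 * (x + k)" and y: "n \<le> 2 * y"
    and p: "64 * (k + L) / (n * s) \<le> p" and L: "0 \<le> L"
  shows "k \<le> x" "k \<le> y"
    "3 * k + (p * (x * y) / 8 - p * ((x - k) * (y - k))) \<le> - (2 * L * j)"
proof -
  have js: "s \<le> j * s" using mult_right_mono[of 1 j s] j k by simp
  have "j * (15 / 17 * s) \<le> j * (s - 2 * k)" using j k by (intro mult_left_mono) auto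
  then have x1: "j * s * (13 / 34) \<le> x" using x k js by argo
  then have kx: "k \<le> 2 / 13 * x" using k js by linarith
  have ky: "k \<le> 2 / 17 * y" using k y by linarith
  show "k \<le> x" "k \<le> y" using kx ky k by linarith+
  have pos: "0 < x" "0 < y" "0 < n" "0 < s" using kx ky k by linarith+
  have p0: "0 \<le> p" using p pos k L by (smt (verit) divide_nonneg_pos mult_pos_pos)
  have "(11 / 13 * x) * (15 / 17 * y) \<le> (x - k) * (y - k)"
    using kx ky pos k by (intro mult_mono) auto
  moreover have "0 \<le> x * y" using pos by simp
  \<comment> \<open>The product of \<open>11 / 13\<close> and \<open>15 / 17\<close> exceeds
    \<open>5 / 8\<close>. After subtracting the \<open>1 / 8\<close> lost to the matchings, half of
    \<open>p * x * y\<close> remains.\<close>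
  ultimately have xy: "5 / 8 * (x * y) \<le> (x - k) * (y - k)" by argo
  have "(j * s * (13 / 34)) * (n / 2) \<le> x * y"
    using x1 y pos j k by (intro mult_mono) auto
  moreover have "(j * s * (13 / 34)) * (n / 2) = 13 / 68 * (n * s * j)" by simp
  moreover have "0 \<le> n * s * j" using pos j by simp
  ultimately have nsj: "2 / 12 * (n * s * j) \<le> x * y" by argo
  have "64 * (k + L) \<le> p * (n * s)" using p pos by (simp add: field_simps)
  then have "64 * (k + L) * j \<le> p * (n * s) * j" using j by (intro mult_right_mono) auto
  also have "\<dots> = 6 * (p * (2 / 12 * (n * s * j)))" by simp
  also have "\<dots> \<le> 6 * (p * (x * y))" using nsj p0 by (intro mult_left_mono) auto
  \<comment> \<open>Half of \<open>p * x * y\<close> is thus at least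
    \<open>16 / 3 * (k + L) * j\<close>, which dominates \<open>3 * k + 2 * L * j\<close>.\<close>
  finally have big: "64 * (k + L) * j \<le> 6 * (p * (x * y))" .
  have "k \<le> k * j" using mult_left_mono[of 1 j k] j k by simp
  moreover have "0 \<le> L * j" using L j by simp
  moreover have "p * (5 / 8 * (x * y)) \<le> p * ((x - k) * (y - k))"
    using xy p0 by (rule mult_left_mono)
  moreover have "64 * (k + L) * j = 64 * (k * j) + 64 * (L * j)"
    "p * (5 / 8 * (x * y)) = 5 / 8 * (p * (x * y))" "2 * L * j = 2 * (L * j)"
    by (simp_all add: algebra_simps)
  ultimately show "3 * k + (p * (x * y) / 8 - p * ((x - k) * (y - k))) \<le> - (2 * L * j)"
    using big k(1) by linarith
qed

text \<open>Union bound with \<open>q = (s/n)^2\<close>: summing \<open>q ^ card I\<close> over the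
  nonempty sets of cells gives \<open>(1 + q) ^ card \<C> - 1\<close>, at most
  \<open>exp (q * card \<C>) - 1\<close>. As there are at most \<open>3 * n / s\<close> cells, the
  failure probability is at most \<open>exp (3 * s / n) - 1\<close>.\<close>

lemma prob_vertex_connectivity_perturbed_ge:
  fixes n k s :: nat and p :: real
  assumes G: "simple_graph {..<n} E" and s: "min_degree {..<n} E = s" and n: "0 < n"
    and k: "0 < k" "17 * k \<le> s" and p01: "0 \<le> p" "p \<le> 1"
    and p: "64 * (real k + ln (real n / real s)) / (real n * real s) \<le> p"
  shows "measure_pmf.prob (binomial_random_graph n p)
      {R. k \<le> vertex_connectivity {..<n} (E \<union> R)} \<ge> 2 - exp (3 * (real s / real n))"
proof -
  let ?P = "measure_pmf.prob (binomial_random_graph n p)"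
  let ?V = "{..<n}"
  define L where "L = ln (real n / real s)"
  have deg: "s \<le> card {u \<in> ?V. {v, u} \<in> E}" if "v \<in> ?V" for v
    using that s unfolding degree_eq_card_neighbours[OF G that, symmetric] min_degree_def
    by (auto intro: Min_le)
  have sn: "s \<le> n"
  proof -
    have "card {u \<in> ?V. {0, u} \<in> E} \<le> card ?V" by (intro card_mono) auto
    then show ?thesis using deg[of 0] n by simp
  qed
  have s0: "0 < s" using k by linarith
  have L: "0 \<le> L" unfolding L_def using sn s0 by simp
  have "\<exists>(\<C> :: nat set set) X Y. finite \<C> \<and> card \<C> * (s - 2 * k) \<le> 2 * card ?V \<and>
    (\<forall>I\<subseteq>\<C>. X I \<subseteq> ?V \<and> Y I \<subseteq> ?V \<and> X I \<inter> Y I = {}) \<and>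
    (\<forall>R S A B. separation ?V (E \<union> R) k S A B \<longrightarrow>
       (\<exists>I\<subseteq>\<C>. I \<noteq> {} \<and> card I * (s - 2 * k) \<le> 2 * (card (X I) + k) \<and> card ?V \<le> 2 * card (Y I) \<and>
          non_adjacent R (X I - S) (Y I - S)))"
    by (rule separation_reduces_to_cells[OF G k deg])
  then obtain \<C> :: "nat set set" and X Y where
      C: "finite \<C>" "card \<C> * (s - 2 * k) \<le> 2 * card ?V"
    and XY: "\<forall>I\<subseteq>\<C>. X I \<subseteq> ?V \<and> Y I \<subseteq> ?V \<and> X I \<inter> Y I = {}"
    and cells: "\<forall>R S A B. separation ?V (E \<union> R) k S A B \<longrightarrow>
       (\<exists>I\<subseteq>\<C>. I \<noteq> {} \<and> card I * (s - 2 * k) \<le> 2 * (card (X I) + k) \<and> card ?V \<le> 2 * card (Y I) \<and>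
          non_adjacent R (X I - S) (Y I - S))"
    by (elim exE conjE)
  \<comment> \<open>These are the index sets that satisfy the size bounds under which the exponent
    estimate applies.\<close>
  define \<I> where "\<I> = {I. I \<subseteq> \<C> \<and> I \<noteq> {} \<and>
    card I * (s - 2 * k) \<le> 2 * (card (X I) + k) \<and> card ?V \<le> 2 * card (Y I)}"
  have finI: "finite \<I>" unfolding \<I>_def using C(1) by (auto intro: finite_subset[of _ "Pow \<C>"])
  define bad where "bad I = {R. \<exists>S. finite S \<and> card S < k \<and> non_adjacent R (X I - S) (Y I - S)}"
    for I
  define q where "q = (real s / real n) ^ 2"
  have q: "exp (- (2 * L)) = q"
  proof -
    have "exp (- (2 * L)) = (exp (- L)) ^ 2" by (simp add: exp_double[symmetric])
    also have "exp (- L) = real s / real n"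
      unfolding L_def exp_minus using s0 n by simp
    finally show ?thesis unfolding q_def .
  qed
  have bad: "?P (bad I) \<le> q ^ card I" if "I \<in> \<I>" for I
  proof -
    have I: "I \<subseteq> \<C>" "I \<noteq> {}" "card I * (s - 2 * k) \<le> 2 * (card (X I) + k)" "n \<le> 2 * card (Y I)"
      using that unfolding \<I>_def by auto
    have "finite I" using I(1) C(1) finite_subset by blast
    then have j: "1 \<le> real (card I)" using I(2) by (simp add: Suc_le_eq card_gt_0_iff)
    have "real (card I * (s - 2 * k)) \<le> real (2 * (card (X I) + k))" using I(3) of_nat_le_iff by blast
    then have x: "real (card I) * (real s - 2 * real k) \<le> 2 * (real (card (X I)) + real k)"
      using k by (simp add: of_nat_diff)
    have y: "real n \<le> 2 * real (card (Y I))" using I(4) by linarith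
    note bounds = small_cover_exponent_le[of "real k" "real s" "real n", OF _ _ _ j x y
        p[folded L_def] L]
    have k': "1 \<le> real k" "17 * real k \<le> real s" "real s \<le> real n" using k sn by linarith+
    have kxy: "k \<le> card (X I)" "k \<le> card (Y I)" using bounds(1,2)[OF k'] by auto
    have "(8::real) ^ k \<le> exp 3 ^ k"
    proof (rule power_mono)
      have "(2::real) ^ 3 \<le> exp 1 ^ 3" using exp_ge_add_one_self[of 1] by (intro power_mono) auto
      then show "(8::real) \<le> exp 3" by (simp flip: exp_of_nat_mult)
    qed simp
    also have "exp 3 ^ k = exp (3 * real k)" by (simp flip: exp_of_nat2_mult)
    finally have e8: "(8::real) ^ k \<le> exp (3 * real k)" .
    have "?P (bad I) \<le> 8 ^ k * exp (p * (card (X I) * card (Y I)) / 8 -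
        p * ((card (X I) - k) * (card (Y I) - k)))"
      unfolding bad_def using XY I(1) kxy p01 by (intro prob_small_cover_le) auto
    also have "\<dots> \<le> exp (3 * real k) * exp (p * (card (X I) * card (Y I)) / 8 -
        p * ((card (X I) - k) * (card (Y I) - k)))"
      using e8 by (intro mult_right_mono) auto
    also have "\<dots> \<le> exp (- (2 * L * real (card I)))"
      using bounds(3)[OF k'] kxy by (simp add: exp_add[symmetric] of_nat_diff)
    also have "\<dots> = exp (- (2 * L)) ^ card I" by (simp add: exp_of_nat_mult[symmetric] mult_ac)
    finally show ?thesis unfolding q .
  qed
  have "{R. \<not> k \<le> vertex_connectivity ?V (E \<union> R)} \<subseteq> (\<Union>I\<in>\<I>. bad I)"
  proof
    fix R assume "R \<in> {R. \<not> k \<le> vertex_connectivity ?V (E \<union> R)}"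
    moreover have "k < card ?V" using k sn by simp
    ultimately obtain S A B where sep: "separation ?V (E \<union> R) k S A B"
      using vertex_connectivity_geI[of ?V k "E \<union> R"] by auto
    then have "finite S" "card S < k"
      unfolding separation_def using finite_subset[OF _ finite_lessThan] by blast+
    moreover have "\<exists>I\<subseteq>\<C>. I \<noteq> {} \<and> card I * (s - 2 * k) \<le> 2 * (card (X I) + k) \<and>
        card ?V \<le> 2 * card (Y I) \<and> non_adjacent R (X I - S) (Y I - S)"
      by (rule cells[rule_format, OF sep])
    then obtain I where "I \<in> \<I>" "non_adjacent R (X I - S) (Y I - S)"
      unfolding \<I>_def by (elim exE conjE) simp
    ultimately show "R \<in> (\<Union>I\<in>\<I>. bad I)" unfolding bad_def by blast
  qed
  then have "?P {R. \<not> k \<le> vertex_connectivity ?V (E \<union> R)} \<le> ?P (\<Union>I\<in>\<I>. bad I)"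
    by (intro measure_pmf.finite_measure_mono) auto
  also have "\<dots> \<le> (\<Sum>I\<in>\<I>. ?P (bad I))"
    using finI by (intro measure_pmf.finite_measure_subadditive_finite) auto
  also have "\<dots> \<le> (\<Sum>I\<in>\<I>. q ^ card I)" using bad by (rule sum_mono)
  also have "\<dots> \<le> (\<Sum>I\<in>Pow \<C> - {{}}. q ^ card I)"
    using C(1) unfolding \<I>_def by (intro sum_mono2) (auto simp: q_def)
  also have "\<dots> = (1 + q) ^ card \<C> - 1"
    using C(1) by (subst sum_diff1) (auto simp: sum_power_card_Pow)
  also have "(1 + q) ^ card \<C> \<le> exp q ^ card \<C>"
    using exp_ge_add_one_self[of q] by (intro power_mono) (auto simp: q_def)
  also have "exp q ^ card \<C> = exp (real (card \<C>) * q)" by (simp add: exp_of_nat_mult)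
  also have "\<dots> \<le> exp (3 * (real s / real n))"
  proof -
    have "real (card \<C> * (s - 2 * k)) \<le> real (2 * n)"
      using C(2) unfolding of_nat_le_iff by simp
    then have "real (card \<C>) * (real s - 2 * real k) \<le> 2 * real n"
      using k by (simp add: of_nat_diff)
    \<comment> \<open>From \<open>17 * k \<le> s\<close>, the difference \<open>s - 2 * k\<close> is
      at least \<open>15 / 17 * s\<close>, hence at least \<open>2 / 3 * s\<close>.\<close>
    moreover have "real (card \<C>) * (2 / 3 * real s) \<le> real (card \<C>) * (real s - 2 * real k)"
      using k by (intro mult_left_mono) auto
    ultimately have "real (card \<C>) * real s \<le> 3 * real n" by argo
    then have "real (card \<C>) * real s * (real s / real n ^ 2) \<le> 3 * real n * (real s / real n ^ 2)"
      by (intro mult_right_mono) auto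
    then have "real (card \<C>) * q \<le> 3 * (real s / real n)"
      using n unfolding q_def by (simp add: power2_eq_square field_simps)
    then show ?thesis by simp
  qed
  finally have "?P {R. \<not> k \<le> vertex_connectivity ?V (E \<union> R)} \<le> exp (3 * (real s / real n)) - 1"
    by simp
  moreover have "?P {R. \<not> k \<le> vertex_connectivity ?V (E \<union> R)} =
      1 - ?P {R. k \<le> vertex_connectivity ?V (E \<union> R)}"
    by (subst measure_pmf.prob_compl[symmetric]) (auto intro!: arg_cong[where f = ?P])
  ultimately show ?thesis by linarith
qed

text \<open>Once \<open>s n < n\<close> the logarithm is positive, so a larger \<open>c\<close> only
  strengthens the lower bound on \<open>p\<close> and the case of 64 applies. The probability is
  then squeezed to 1 because \<open>s n / n\<close> tends to 0.\<close>

lemma perturbed_vertex_connectivity_aas: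
  fixes c :: real and k s :: "nat \<Rightarrow> nat" and G :: "nat \<Rightarrow> nat set set" and p :: "nat \<Rightarrow> real"
  assumes c: "64 \<le> c"
    and ks: "\<And>n. n > 0 \<Longrightarrow> 0 < k n \<and> 0 < s n \<and> real (k n) \<le> real (s n) / 17"
    and s: "(\<lambda>n. real (s n) / real n) \<longlonglongrightarrow> 0"
    and G: "\<forall>\<^sub>F n in sequentially. simple_graph {..<n} (G n) \<and> min_degree {..<n} (G n) = s n"
    and p01: "\<And>n. 0 \<le> p n \<and> p n \<le> 1"
    and p: "\<forall>\<^sub>F n in sequentially.
      p n \<ge> c * (real (k n) + ln (real n / real (s n))) / (real n * real (s n))"
  shows "(\<lambda>n. measure_pmf.prob (binomial_random_graph n (p n))
    {R. vertex_connectivity {..<n} (G n \<union> R) \<ge> k n}) \<longlonglongrightarrow> 1"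
proof (rule tendsto_sandwich)
  have "(\<lambda>n. 2 - exp (3 * (real (s n) / real n))) \<longlonglongrightarrow> 2 - exp (3 * 0)"
    by (intro tendsto_intros s)
  then show "(\<lambda>n. 2 - exp (3 * (real (s n) / real n))) \<longlonglongrightarrow> 1" by simp
  have "\<forall>\<^sub>F n in sequentially. real (s n) / real n < 1"
    using order_tendstoD(2)[OF s] by simp
  then show "\<forall>\<^sub>F n in sequentially. 2 - exp (3 * (real (s n) / real n)) \<le>
      measure_pmf.prob (binomial_random_graph n (p n))
        {R. vertex_connectivity {..<n} (G n \<union> R) \<ge> k n}"
    using G p eventually_gt_at_top[of 0]
  proof eventually_elim
    case (elim n)
    have k: "0 < k n" "17 * k n \<le> s n" "0 < s n" using ks[of n] elim(4) by linarith+
    have "0 \<le> ln (real n / real (s n))" using elim(1,4) k(3) by simp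
    then have "64 * (real (k n) + ln (real n / real (s n))) / (real n * real (s n)) \<le>
        c * (real (k n) + ln (real n / real (s n))) / (real n * real (s n))"
      using c by (intro divide_right_mono mult_right_mono) auto
    then show ?case
      using elim k p01[of n] by (intro prob_vertex_connectivity_perturbed_ge) auto
  qed
qed auto

subsection \<open>Disjoint cliques\<close>

text \<open>A path starting in \<open>A\<close> and avoiding \<open>S\<close> never enters
  \<open>B\<close>, by induction on its length.\<close>

lemma separation_not_connected:
  assumes sep: "separation V E k S A B"
  shows "\<not> connected_graph (V - S) {e \<in> E. e \<subseteq> V - S}"
proof
  assume conn: "connected_graph (V - S) {e \<in> E. e \<subseteq> V - S}"
  let ?r = "{(x, y). x \<in> V - S \<and> y \<in> V - S \<and> {x, y} \<in> {e \<in> E. e \<subseteq> V - S}}"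
  have AB: "V - S = A \<union> B" "A \<inter> B = {}" "A \<noteq> {}" "B \<noteq> {}" "non_adjacent E A B"
    using sep unfolding separation_def by auto
  then obtain a b where ab: "a \<in> A" "b \<in> B" by blast
  have "(a, b) \<in> ?r\<^sup>*" using conn ab AB(1) unfolding connected_graph_def by blast
  then have "b \<in> A"
  proof (induction rule: rtrancl_induct)
    case (step y z)
    then have "z \<notin> B" using AB(5) unfolding non_adjacent_def by blast
    then show ?case using step(2) AB(1) by blast
  qed (rule ab)
  then show False using ab AB(2) by blast
qed

lemma separation_imp_vertex_connectivity_less:
  assumes "separation V E k S A B"
  shows "vertex_connectivity V E < k"
proof -
  have "S \<subseteq> V" "card S < k" using assms unfolding separation_def by auto
  moreover have "vertex_connectivity V E \<le> card S"
    unfolding vertex_connectivity_def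
    using separation_not_connected[OF assms] \<open>S \<subseteq> V\<close> by (intro Least_le) blast
  ultimately show ?thesis by linarith
qed

section \<open>Disjoint cliques on the residue classes\<close>

definition residue_class :: "nat \<Rightarrow> nat \<Rightarrow> nat \<Rightarrow> nat set" where
  "residue_class n m i = {v \<in> {..<n}. v mod m = i}"

definition residue_cliques :: "nat \<Rightarrow> nat \<Rightarrow> nat set set" where
  "residue_cliques n m = {e \<in> [{..<n}]\<^bsup>2\<^esup>. \<forall>u\<in>e. \<forall>v\<in>e. u mod m = v mod m}"

text \<open>No edge of \<open>residue_cliques n m \<union> R\<close> leaves the class exactly when
  \<open>R\<close> is disjoint from this set.\<close>

definition residue_cut :: "nat \<Rightarrow> nat \<Rightarrow> nat \<Rightarrow> nat set set" where
  "residue_cut n m i = cross_pairs (residue_class n m i) ({..<n} - residue_class n m i)"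

lemma finite_residue_class [simp]: "finite (residue_class n m i)"
  by (simp add: residue_class_def)

lemma residue_class_subset: "residue_class n m i \<subseteq> {..<n}"
  by (auto simp: residue_class_def)

lemma card_residue_class_ge:
  assumes "i < m"
  shows "n div m \<le> card (residue_class n m i)"
proof -
  have "(\<lambda>t. i + m * t) ` {..<n div m} \<subseteq> residue_class n m i"
  proof clarify
    fix t assume "t < n div m"
    then have "m * Suc t \<le> m * (n div m)" by (intro mult_left_mono) auto
    also have "\<dots> \<le> n" by simp
    finally show "i + m * t \<in> residue_class n m i"
      using assms unfolding residue_class_def by simp
  qed
  then have "card ((\<lambda>t. i + m * t) ` {..<n div m}) \<le> card (residue_class n m i)"
    by (intro card_mono) auto
  moreover have "inj_on (\<lambda>t. i + m * t) {..<n div m}" using assms by (auto simp: inj_on_def)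
  ultimately show ?thesis by (simp add: card_image)
qed

lemma card_residue_class_le: "card (residue_class n m i) \<le> n div m + 1"
proof -
  have "inj_on (\<lambda>v. v div m) (residue_class n m i)"
    unfolding inj_on_def residue_class_def by (metis (lifting) div_mult_mod_eq mem_Collect_eq)
  moreover have "(\<lambda>v. v div m) ` residue_class n m i \<subseteq> {..n div m}"
    by (auto simp: residue_class_def intro: div_le_mono)
  ultimately have "card (residue_class n m i) \<le> card {..n div m}"
    by (intro card_inj_on_le) auto
  then show ?thesis by simp
qed

lemma simple_graph_residue_cliques: "simple_graph {..<n} (residue_cliques n m)"
  by (auto simp: simple_graph_def residue_cliques_def)

lemma min_degree_residue_cliques_ge:
  assumes "0 < n" "0 < m"
  shows "n div m - 1 \<le> min_degree {..<n} (residue_cliques n m)"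
  unfolding min_degree_def
proof (rule Min.boundedI)
  fix d assume "d \<in> degree (residue_cliques n m) ` {..<n}"
  then obtain v where v: "v < n" "d = degree (residue_cliques n m) v" by blast
  have "d = card {u \<in> {..<n}. {v, u} \<in> residue_cliques n m}"
    using degree_eq_card_neighbours[OF simple_graph_residue_cliques] v by simp
  also have "{u \<in> {..<n}. {v, u} \<in> residue_cliques n m} = residue_class n m (v mod m) - {v}"
    using v(1) by (auto simp: residue_cliques_def residue_class_def doubleton_in_nsets_2)
  also have "card \<dots> = card (residue_class n m (v mod m)) - 1"
    using v(1) by (intro card_Diff_singleton) (auto simp: residue_class_def)
  finally show "n div m - 1 \<le> d"
    using card_residue_class_ge[of "v mod m" m n] assms(2) by simp
qed (use assms in auto)

lemma residue_class_complement_nonempty: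
  assumes "2 \<le> m" "m \<le> n" "i < m"
  shows "{..<n} - residue_class n m i \<noteq> {}"
proof -
  \<comment> \<open>Both 0 and 1 are vertices, and \<open>2 \<le> m\<close> puts them in different
    classes.\<close>
  have "(if i = 0 then 1 else 0) \<in> {..<n} - residue_class n m i"
    using assms by (auto simp: residue_class_def)
  then show ?thesis by blast
qed

text \<open>Deleting \<open>S\<close> destroys every edge of \<open>H\<close> leaving the class, and
  \<open>card S < n div m\<close> ensures that part of the class survives. With \<open>S\<close>
  empty this also covers isolated cliques.\<close>

lemma residue_cliques_separation:
  assumes m: "2 \<le> m" "m \<le> n" "i < m" and S: "S \<subseteq> residue_class n m i" "card S < k"
    "card S < n div m" and H: "\<And>e. e \<in> H \<inter> residue_cut n m i \<Longrightarrow> e \<inter> S \<noteq> {}"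
  shows "separation {..<n} (residue_cliques n m \<union> H) k S
    (residue_class n m i - S) ({..<n} - residue_class n m i)"
proof -
  let ?C = "residue_class n m i"
  have "?C - S \<noteq> {}"
  proof
    assume "?C - S = {}"
    then have "S = ?C" using S(1) by blast
    then show False using S(3) card_residue_class_ge[OF m(3), of n] by simp
  qed
  moreover have "non_adjacent (residue_cliques n m \<union> H) (?C - S) ({..<n} - ?C)"
    unfolding non_adjacent_def
  proof (intro ballI notI)
    fix a b assume ab: "a \<in> ?C - S" "b \<in> {..<n} - ?C" "{a, b} \<in> residue_cliques n m \<union> H"
    then have "{a, b} \<notin> residue_cliques n m"
      by (auto simp: residue_cliques_def residue_class_def)
    moreover have "{a, b} \<in> residue_cut n m i"
      using ab unfolding residue_cut_def cross_pairs_iff by blast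
    ultimately have "{a, b} \<inter> S \<noteq> {}" using ab(3) H by blast
    then show False using ab S(1) by blast
  qed
  ultimately show ?thesis
    using residue_class_complement_nonempty[OF m] S residue_class_subset[of n m i]
    unfolding separation_def by blast
qed

text \<open>Fewer than \<open>k * m / 2\<close> extra edges leave some clique with fewer than \<open>k\<close> edges to the
  outside; deleting their endpoints in the clique separates the rest of it.\<close>

lemma vertex_connectivity_residue_cliques_Un_less:
  assumes m: "2 \<le> m" "m \<le> n" and k: "k \<le> n div m"
    and H: "simple_graph {..<n} H" "2 * card H < k * m"
  shows "vertex_connectivity {..<n} (residue_cliques n m \<union> H) < k"
proof -
  have finH: "finite H" using simple_graph_finite[OF H(1)] .
  \<comment> \<open>Double counting: an edge lies in at most two cuts, those of the classes of its
    endpoints. Averaging over the \<open>m\<close> classes then finds a cut with fewer than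
    \<open>k\<close> edges of \<open>H\<close>.\<close>
  have "(\<Sum>i<m. card (H \<inter> residue_cut n m i)) = (\<Sum>i<m. \<Sum>e\<in>H. if e \<in> residue_cut n m i then 1 else 0)"
    using finH by (simp add: sum.inter_restrict[symmetric])
  also have "\<dots> = (\<Sum>e\<in>H. \<Sum>i<m. if e \<in> residue_cut n m i then 1 else 0)" by (rule sum.swap)
  also have "\<dots> = (\<Sum>e\<in>H. card {i \<in> {..<m}. e \<in> residue_cut n m i})"
    by (simp add: sum.If_cases Int_def)
  also have "\<dots> \<le> (\<Sum>e\<in>H. 2)"
  proof (rule sum_mono)
    fix e assume "e \<in> H"
    then have "card e = 2" using simple_graph_edge_card[OF H(1)] by blast
    then obtain x y where e: "e = {x, y}" by (meson card_2_iff)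
    have "{i \<in> {..<m}. e \<in> residue_cut n m i} \<subseteq> {x mod m, y mod m}"
      unfolding e residue_cut_def cross_pairs_iff by (auto simp: residue_class_def doubleton_eq_iff)
    then have "card {i \<in> {..<m}. e \<in> residue_cut n m i} \<le> card {x mod m, y mod m}"
      by (intro card_mono) auto
    also have "\<dots> \<le> 2" by (simp add: card_insert_if)
    finally show "card {i \<in> {..<m}. e \<in> residue_cut n m i} \<le> 2" .
  qed
  finally have total: "(\<Sum>i<m. card (H \<inter> residue_cut n m i)) < k * m" using H(2) by simp
  have "\<exists>i<m. card (H \<inter> residue_cut n m i) < k"
  proof (rule ccontr)
    assume "\<not> ?thesis"
    then have "(\<Sum>i<m. k) \<le> (\<Sum>i<m. card (H \<inter> residue_cut n m i))"
      by (intro sum_mono) (meson lessThan_iff not_le)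
    then show False using total by (simp add: mult.commute)
  qed
  then obtain i where i: "i < m" "card (H \<inter> residue_cut n m i) < k" by blast
  define S where "S = residue_class n m i \<inter> \<Union>(H \<inter> residue_cut n m i)"
  have "card S \<le> card (H \<inter> residue_cut n m i)"
    unfolding S_def using finH
    by (intro card_Int_Union_cross_pairs[where Y = "{..<n} - residue_class n m i"])
      (auto simp: residue_cut_def)
  then have card_S: "card S < k" using i(2) by linarith
  have "separation {..<n} (residue_cliques n m \<union> H) k S
      (residue_class n m i - S) ({..<n} - residue_class n m i)"
  proof (rule residue_cliques_separation[OF m i(1)])
    fix e assume e: "e \<in> H \<inter> residue_cut n m i"
    then obtain x y where "e = {x, y}" "x \<in> residue_class n m i"
      unfolding residue_cut_def Int_iff cross_pairs_iff by blast
    then show "e \<inter> S \<noteq> {}" using e unfolding S_def by blast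
  qed (use card_S k in \<open>auto simp: S_def\<close>)
  then show ?thesis by (rule separation_imp_vertex_connectivity_less)
qed

section \<open>The second moment method\<close>

lemma finite_set_pmf_binomial_random_graph: "finite (set_pmf (binomial_random_graph n p))"
  unfolding binomial_random_graph_def
  by (rule finite_subset[of _ "Pow ([{..<n}]\<^bsup>2\<^esup>)"]) (auto simp: finite_imp_finite_nsets)

text \<open>Chebyshev's inequality for the number \<open>W\<close> of sets \<open>F i\<close> that
  \<open>R\<close> misses, whose mean is \<mu>. Overlaps of size at most \<open>b\<close> raise the
  pair probabilities by a factor of at most \<open>1 / (1 - p) ^ b\<close>.\<close>

lemma prob_all_met_le:
  fixes F :: "'i \<Rightarrow> nat set set" and p :: real
  assumes T: "finite T" and F: "\<And>i. i \<in> T \<Longrightarrow> F i \<subseteq> [{..<n}]\<^bsup>2\<^esup>"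
    and b: "\<And>i j. i \<in> T \<Longrightarrow> j \<in> T \<Longrightarrow> i \<noteq> j \<Longrightarrow> card (F i \<inter> F j) \<le> b"
    and p: "0 \<le> p" "p < 1" and \<mu>: "\<mu> = (\<Sum>i\<in>T. (1 - p) ^ card (F i))" "0 < \<mu>"
  shows "measure_pmf.prob (binomial_random_graph n p) {R. \<forall>i\<in>T. R \<inter> F i \<noteq> {}}
    \<le> 1 / \<mu> + 1 / (1 - p) ^ b - 1"
proof -
  let ?M = "binomial_random_graph n p"
  let ?P = "measure_pmf.prob ?M"
  define Q where "Q i = (1 - p) ^ card (F i)" for i
  define W where "W R = (\<Sum>i\<in>T. indicator {R. R \<inter> F i = {}} R :: real)" for R
  have int: "integrable (measure_pmf ?M) f" for f :: "nat set set \<Rightarrow> real"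
    by (rule integrable_measure_pmf_finite[OF finite_set_pmf_binomial_random_graph])
  have prob: "?P {R. R \<inter> A = {}} = (1 - p) ^ card A" if "A \<subseteq> [{..<n}]\<^bsup>2\<^esup>" for A
    using prob_binomial_random_graph[of "{}" n A p] that p by simp
  have EW: "measure_pmf.expectation ?M W = \<mu>"
    unfolding W_def \<mu>(1) using F prob by (simp add: int)
  have pair: "?P {R. R \<inter> (F i \<union> F j) = {}} \<le> (if i = j then Q i else 0) + Q i * Q j / (1 - p) ^ b"
    if ij: "i \<in> T" "j \<in> T" for i j
  proof (cases "i = j")
    case True
    then show ?thesis using prob F ij p unfolding Q_def by simp
  next
    case False
    have fin: "finite (F i)" "finite (F j)"
      using F ij finite_imp_finite_nsets[of "{..<n}" 2] finite_subset by blast+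
    have "card (F i) + card (F j) \<le> card (F i \<union> F j) + b"
      using card_Un_Int[OF fin] b[OF ij False] by linarith
    then have "(1 - p) ^ (card (F i \<union> F j) + b) \<le> (1 - p) ^ (card (F i) + card (F j))"
      using p by (intro power_decreasing) auto
    then have "(1 - p) ^ card (F i \<union> F j) \<le> Q i * Q j / (1 - p) ^ b"
      unfolding Q_def using p by (simp add: power_add pos_le_divide_eq)
    then show ?thesis using prob[of "F i \<union> F j"] F ij False by simp
  qed
  have W2: "W R ^ 2 = (\<Sum>i\<in>T. \<Sum>j\<in>T. indicator {R. R \<inter> (F i \<union> F j) = {}} R)" for R
    unfolding W_def power2_eq_square sum_product
    by (intro sum.cong refl) (auto simp: indicator_def Int_Un_distrib)
  have "measure_pmf.expectation ?M (\<lambda>R. W R ^ 2) = (\<Sum>i\<in>T. \<Sum>j\<in>T. ?P {R. R \<inter> (F i \<union> F j) = {}})"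
    unfolding W2 by (simp add: int)
  also have "\<dots> \<le> (\<Sum>i\<in>T. \<Sum>j\<in>T. (if i = j then Q i else 0) + Q i * Q j / (1 - p) ^ b)"
    by (intro sum_mono pair)
  also have "\<dots> = \<mu> + \<mu> * \<mu> / (1 - p) ^ b"
  proof -
    have "(\<Sum>i\<in>T. \<Sum>j\<in>T. Q i * Q j / (1 - p) ^ b) = \<mu> * \<mu> / (1 - p) ^ b"
      unfolding \<mu>(1) Q_def[symmetric] sum_product sum_divide_distrib ..
    moreover have "(\<Sum>i\<in>T. \<Sum>j\<in>T. if i = j then Q i else 0) = \<mu>"
      unfolding \<mu>(1) Q_def[symmetric] using T by simp
    ultimately show ?thesis by (simp add: sum.distrib)
  qed
  finally have EW2: "measure_pmf.expectation ?M (\<lambda>R. W R ^ 2) \<le> \<mu> + \<mu> * \<mu> / (1 - p) ^ b" .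
  have "\<mu> ^ 2 * ?P {R. \<forall>i\<in>T. R \<inter> F i \<noteq> {}} =
      measure_pmf.expectation ?M (\<lambda>R. \<mu> ^ 2 * indicator {R. \<forall>i\<in>T. R \<inter> F i \<noteq> {}} R)"
    by (simp add: int)
  \<comment> \<open>If every \<open>F i\<close> is met then \<open>W = 0\<close>, so the square of
    \<open>W - \<mu>\<close> is at least the square of \<mu> on that event.\<close>
  also have "\<dots> \<le> measure_pmf.expectation ?M (\<lambda>R. W R ^ 2 - 2 * \<mu> * W R + \<mu> ^ 2)"
  proof (rule integral_mono[OF int int])
    fix R
    have sq: "W R ^ 2 - 2 * \<mu> * W R + \<mu> ^ 2 = (W R - \<mu>) ^ 2"
      by (simp add: power2_eq_square algebra_simps)
    show "\<mu> ^ 2 * indicator {R. \<forall>i\<in>T. R \<inter> F i \<noteq> {}} R \<le> W R ^ 2 - 2 * \<mu> * W R + \<mu> ^ 2"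
    proof (cases "\<forall>i\<in>T. R \<inter> F i \<noteq> {}")
      case True
      then have "W R = 0" unfolding W_def by (intro sum.neutral) auto
      then show ?thesis by (simp add: indicator_def)
    next
      case False
      then have "indicator {R. \<forall>i\<in>T. R \<inter> F i \<noteq> {}} R = (0 :: real)" by simp
      then show ?thesis unfolding sq by simp
    qed
  qed
  also have "\<dots> = measure_pmf.expectation ?M (\<lambda>R. W R ^ 2) - 2 * \<mu> * \<mu> + \<mu> ^ 2"
    by (simp add: int EW)
  also have "\<dots> \<le> \<mu> ^ 2 * (1 / \<mu> + 1 / (1 - p) ^ b - 1)"
    using EW2 \<mu>(2) by (simp add: power2_eq_square algebra_simps)
  finally show ?thesis using \<mu>(2) by (simp add: mult_le_cancel_left_pos)
qed

text \<open>Class sizes are at most \<open>a\<close>, so a cut has at most \<open>a * n\<close>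
  pairs. Two different cuts share only pairs joining the two classes, at most \<open>a * a\<close>,
  which is the overlap bound in the second moment estimate.\<close>

lemma prob_isolated_residue_class_ge:
  assumes m: "2 \<le> m" "m \<le> n" and p: "0 \<le> p" "p < 1" and a: "a = n div m + 1"
  shows "measure_pmf.prob (binomial_random_graph n p)
      {R. vertex_connectivity {..<n} (residue_cliques n m \<union> R) = 0}
    \<ge> 2 - 1 / (m * (1 - p) ^ (a * n)) - 1 / (1 - p) ^ (a * a)"
proof -
  let ?P = "measure_pmf.prob (binomial_random_graph n p)"
  let ?C = "residue_class n m"
  define \<mu> where "\<mu> = (\<Sum>i<m. (1 - p) ^ card (residue_cut n m i))"
  have card_cut: "card (residue_cut n m i) \<le> a * n" for i
  proof -
    have "card (residue_cut n m i) = card (?C i) * card ({..<n} - ?C i)"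
      unfolding residue_cut_def by (rule card_cross_pairs) auto
    also have "\<dots> \<le> a * card {..<n}"
      using card_residue_class_le[of n m i] unfolding a by (intro mult_le_mono card_mono) auto
    finally show ?thesis by simp
  qed
  have "(\<Sum>i<m. (1 - p) ^ (a * n)) \<le> \<mu>"
    unfolding \<mu>_def using card_cut p by (intro sum_mono power_decreasing) auto
  then have \<mu>: "m * (1 - p) ^ (a * n) \<le> \<mu>" by simp
  have pos: "0 < m * (1 - p) ^ (a * n)" using m p by simp
  have "{R. vertex_connectivity {..<n} (residue_cliques n m \<union> R) \<noteq> 0} \<subseteq>
      {R. \<forall>i\<in>{..<m}. R \<inter> residue_cut n m i \<noteq> {}}"
  proof (rule subsetI, rule CollectI, intro ballI notI)
    fix R i assume i: "i \<in> {..<m}" "R \<inter> residue_cut n m i = {}"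
      and ne: "R \<in> {R. vertex_connectivity {..<n} (residue_cliques n m \<union> R) \<noteq> 0}"
    have "n div m > 0" using m by (simp add: div_greater_zero_iff)
    \<comment> \<open>The empty separator with bound 1 makes the connectivity less than 1, hence
      0.\<close>
    then have "separation {..<n} (residue_cliques n m \<union> R) 1 {} (?C i - {}) ({..<n} - ?C i)"
      using i by (intro residue_cliques_separation[OF m]) auto
    then have "vertex_connectivity {..<n} (residue_cliques n m \<union> R) < 1"
      by (rule separation_imp_vertex_connectivity_less)
    then show False using ne by simp
  qed
  then have "?P {R. vertex_connectivity {..<n} (residue_cliques n m \<union> R) \<noteq> 0} \<le>
      ?P {R. \<forall>i\<in>{..<m}. R \<inter> residue_cut n m i \<noteq> {}}"
    by (intro measure_pmf.finite_measure_mono) auto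
  also have "\<dots> \<le> 1 / \<mu> + 1 / (1 - p) ^ (a * a) - 1"
  proof (rule prob_all_met_le[OF _ _ _ p \<mu>_def])
    fix i j assume ij: "i \<in> {..<m}" "j \<in> {..<m}" "i \<noteq> j"
    have disj: "?C i \<inter> ?C j = {}" using ij(3) by (auto simp: residue_class_def)
    have "residue_cut n m i \<inter> residue_cut n m j \<subseteq> cross_pairs (?C i) (?C j)"
    proof
      fix e assume "e \<in> residue_cut n m i \<inter> residue_cut n m j"
      then obtain x y x' y' where "e = {x, y}" "x \<in> ?C i" "y \<notin> ?C i" "e = {x', y'}" "x' \<in> ?C j" "y' \<notin> ?C j"
        unfolding residue_cut_def Int_iff cross_pairs_iff by blast
      then have "e = {x, y}" "x \<in> ?C i" "y \<in> ?C j"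
        using disj by (auto simp: doubleton_eq_iff)
      then show "e \<in> cross_pairs (?C i) (?C j)" unfolding cross_pairs_iff by blast
    qed
    then have "card (residue_cut n m i \<inter> residue_cut n m j) \<le> card (cross_pairs (?C i) (?C j))"
      by (intro card_mono) (auto simp: finite_cross_pairs)
    also have "\<dots> = card (?C i) * card (?C j)" by (rule card_cross_pairs[OF disj])
    also have "\<dots> \<le> a * a" unfolding a by (intro mult_le_mono card_residue_class_le)
    finally show "card (residue_cut n m i \<inter> residue_cut n m j) \<le> a * a" .
  next
    fix i show "residue_cut n m i \<subseteq> [{..<n}]\<^bsup>2\<^esup>"
      unfolding residue_cut_def
      by (intro cross_pairs_subset_nsets) (auto simp: residue_class_def)
  qed (use \<mu> pos in auto)
  also have "1 / \<mu> \<le> 1 / (m * (1 - p) ^ (a * n))"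
    by (rule frac_le[OF _ order_refl pos \<mu>]) simp
  finally have "?P {R. vertex_connectivity {..<n} (residue_cliques n m \<union> R) \<noteq> 0} \<le>
      1 / (m * (1 - p) ^ (a * n)) + 1 / (1 - p) ^ (a * a) - 1" by simp
  moreover have "?P {R. vertex_connectivity {..<n} (residue_cliques n m \<union> R) \<noteq> 0} =
      1 - ?P {R. vertex_connectivity {..<n} (residue_cliques n m \<union> R) = 0}"
    by (subst measure_pmf.prob_compl[symmetric]) (auto intro!: arg_cong[where f = ?P])
  ultimately show ?thesis by linarith
qed

subsection \<open>Isolated cliques below the threshold\<close>

text \<open>The reciprocal \<open>1 / (1 - p)\<close> equals \<open>1 + p / (1 - p)\<close>, which
  is at most \<open>exp (p / (1 - p))\<close>.\<close>

lemma exp_le_one_minus_power: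
  fixes p :: real
  assumes "p < 1"
  shows "exp (- (p / (1 - p) * real N)) \<le> (1 - p) ^ N"
proof -
  have "1 / (1 - p) = 1 + p / (1 - p)" using assms by (simp add: field_simps)
  also have "\<dots> \<le> exp (p / (1 - p))" by (rule exp_ge_add_one_self)
  finally have "exp (- (p / (1 - p))) \<le> 1 - p"
    using assms by (simp add: exp_minus field_simps)
  then have "exp (- (p / (1 - p))) ^ N \<le> (1 - p) ^ N" by (rule power_mono) simp
  then show ?thesis by (simp add: exp_of_nat_mult[symmetric] mult.commute)
qed

text \<open>The third bound says that there are at least \<open>n / (4 * s)\<close> cliques. In the
  last, the factor of \<open>s\<close> tends to 1 when \<open>s\<close> tends to infinity with
  \<open>s = o(n)\<close>; its final summand \<open>1 / s\<close> absorbs the rounding term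
  1.\<close>

lemma div_div_Suc_bounds:
  fixes n s :: nat
  assumes s: "0 < s" and n: "2 * (s + 1) \<le> n"
  defines "m \<equiv> n div (s + 1)"
  shows "2 \<le> m" "m \<le> n" "real n \<le> 4 * (real m * real s)"
    "real (n div m + 1) \<le> ((1 + 1 / real s) / (1 - real s / real n - 1 / real n) + 1 / real s) * real s"
proof -
  show m2: "2 \<le> m" unfolding m_def using n by (simp add: less_eq_div_iff_mult_less_eq)
  show "m \<le> n" unfolding m_def by simp
  have "n < (m + 1) * (s + 1)"
    unfolding m_def using dividend_less_div_times[of "s + 1" n] by simp
  then have "real n < real ((m + 1) * (s + 1))" by (rule of_nat_less_iff[THEN iffD2])
  then have nm: "real n < (real m + 1) * (real s + 1)" by (simp add: algebra_simps)
  have nr: "2 * real s + 2 \<le> real n" using of_nat_mono[OF n, where 'a = real] by simp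
  have s1: "1 \<le> real s" using s by simp
  have ms: "real n - real s - 1 \<le> real m * (real s + 1)" using nm by (simp add: algebra_simps)
  have "real m * 1 \<le> real m * real s" using s1 by (intro mult_left_mono) auto
  then show "real n \<le> 4 * (real m * real s)" using ms nr by (simp add: algebra_simps)
  let ?d = "1 - real s / real n - 1 / real n"
  have n0: "0 < real n" using n by simp
  have d: "?d * real n = real n - real s - 1" using n0 by (simp add: field_simps)
  have "0 < ?d * real n" unfolding d using nr s1 by linarith
  then have d0: "0 < ?d" using n0 by (simp add: zero_less_mult_iff)
  have "real (n div m) \<le> real n / real m" by (rule of_nat_div_le_of_nat)
  also have "\<dots> \<le> (real s + 1) / ?d"
  proof -
    have "real n * ?d \<le> (real s + 1) * real m" using ms d by (simp only: mult.commute)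
    then show ?thesis using d0 m2 by (simp add: pos_divide_le_eq pos_le_divide_eq)
  qed
  also have "real s + 1 = (1 + 1 / real s) * real s" using s1 by (simp add: field_simps)
  finally have "real (n div m) \<le> (1 + 1 / real s) / ?d * real s" by simp
  moreover have "1 / real s * real s = 1" using s1 by simp
  ultimately show "real (n div m + 1) \<le> ((1 + 1 / real s) / ?d + 1 / real s) * real s"
    by (simp add: distrib_right)
qed

text \<open>The condition on \<epsilon> leaves a slack of \<open>sqrt L\<close> in the exponent:
  \<open>(1 - p) ^ (a * n)\<close> is at least \<open>s / n * exp (sqrt L)\<close>, so the expected
  number of isolated cliques is at least \<open>exp (sqrt L) / 4\<close>.\<close>

lemma prob_disconnected_ge:
  fixes n s :: nat and p \<epsilon> :: real
  defines "m \<equiv> n div (s + 1)" and "L \<equiv> ln (real n / real s)"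
    and "P \<equiv> ln (real n / real s) / (real n * real s)"
    and "\<beta> \<equiv> (1 + 1 / real s) / (1 - real s / real n - 1 / real n) + 1 / real s"
  assumes s: "0 < s" and n: "2 * (s + 1) \<le> n" and P: "P \<le> 1 / 2"
    and p: "0 \<le> p" "p \<le> (1 - \<epsilon>) * P" and \<epsilon>: "0 \<le> \<epsilon>" "(1 - \<epsilon>) * (\<beta> / (1 - P)) \<le> 1 - 1 / sqrt L"
  shows "measure_pmf.prob (binomial_random_graph n p)
      {R. vertex_connectivity {..<n} (residue_cliques n m \<union> R) = 0}
    \<ge> 2 - 4 * exp (- sqrt L) - exp (2 * \<beta>\<^sup>2 * (L * (real s / real n)))"
proof -
  note bounds = div_div_Suc_bounds[OF s n, folded m_def \<beta>_def]
  define a where "a = n div m + 1"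
  have a: "real a \<le> \<beta> * real s" using bounds(4) unfolding a_def .
  have pos: "0 < real n" "0 < real s" using s n by auto
  have L: "0 < L" unfolding L_def using s n by simp
  have PL: "P * (real n * real s) = L" unfolding P_def L_def using pos by simp
  have P0: "0 < P" unfolding P_def L_def[symmetric] using L pos by simp
  have "(1 - \<epsilon>) * P \<le> 1 * P" using \<epsilon>(1) P0 by (intro mult_right_mono) auto
  then have pP: "p \<le> P" using p by simp
  then have p1: "p < 1" using P by linarith
  have frac: "p / (1 - p) \<le> (1 - \<epsilon>) * P / (1 - P)"
    using p pP P by (intro frac_le) auto
  have "p / (1 - p) * real (a * n) \<le> (1 - \<epsilon>) * P / (1 - P) * (\<beta> * real s * real n)"
    using frac a p p1 P by (intro mult_mono) (auto intro!: mult_right_mono divide_nonneg_pos)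
  also have "\<dots> = (1 - \<epsilon>) * (\<beta> / (1 - P)) * (P * (real n * real s))" by simp
  also have "\<dots> \<le> (1 - 1 / sqrt L) * L"
    unfolding PL using \<epsilon>(2) L by (intro mult_right_mono) auto
  also have "\<dots> = L - sqrt L" using L by (simp add: left_diff_distrib real_div_sqrt)
  finally have "- (L - sqrt L) \<le> - (p / (1 - p) * real (a * n))" by linarith
  then have "exp (- (L - sqrt L)) \<le> exp (- (p / (1 - p) * real (a * n)))"
    unfolding exp_le_cancel_iff .
  also have "\<dots> \<le> (1 - p) ^ (a * n)" by (rule exp_le_one_minus_power[OF p1])
  finally have e: "exp (- (L - sqrt L)) \<le> (1 - p) ^ (a * n)" .
  have "exp (- L) = real s / real n" unfolding L_def exp_minus using pos by simp
  moreover have "exp (- (L - sqrt L)) = exp (- L) * exp (sqrt L)" by (simp flip: exp_add)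
  ultimately have "exp (- (L - sqrt L)) = real s / real n * exp (sqrt L)" by simp
  then have "real m * (real s / real n) * exp (sqrt L) \<le> m * (1 - p) ^ (a * n)"
    using mult_left_mono[OF e, of "real m"] by (simp add: mult.assoc)
  moreover have "1 / 4 * exp (sqrt L) \<le> real m * (real s / real n) * exp (sqrt L)"
    using bounds(3) pos by (intro mult_right_mono) (auto simp: field_simps)
  ultimately have mu: "1 / 4 * exp (sqrt L) \<le> m * (1 - p) ^ (a * n)" by linarith
  have "1 / (m * (1 - p) ^ (a * n)) \<le> 1 / (1 / 4 * exp (sqrt L))"
    by (rule frac_le[OF zero_le_one order_refl _ mu]) simp
  then have first: "1 / (m * (1 - p) ^ (a * n)) \<le> 4 * exp (- sqrt L)"
    by (simp add: exp_minus field_simps)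
  \<comment> \<open>The correlation term needs no sharp constant, so \<open>1 - p\<close> is simply
    bounded below by \<open>1 / 2\<close>.\<close>
  have "p / (1 - p) \<le> P / (1 / 2)" using p pP P by (intro frac_le) auto
  then have "p / (1 - p) * real (a * a) \<le> P / (1 / 2) * ((\<beta> * real s) * (\<beta> * real s))"
    using a p p1 P0 by (simp only: of_nat_mult) (intro mult_mono; simp)
  also have "\<dots> = 2 * \<beta>\<^sup>2 * (P * (real n * real s) * (real s / real n))"
    using pos by (simp add: power2_eq_square)
  finally have "p / (1 - p) * real (a * a) \<le> 2 * \<beta>\<^sup>2 * (L * (real s / real n))" unfolding PL .
  then have "exp (- (2 * \<beta>\<^sup>2 * (L * (real s / real n)))) \<le> exp (- (p / (1 - p) * real (a * a)))"
    by simp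
  also have "\<dots> \<le> (1 - p) ^ (a * a)" by (rule exp_le_one_minus_power[OF p1])
  finally have "1 / (1 - p) ^ (a * a) \<le> 1 / exp (- (2 * \<beta>\<^sup>2 * (L * (real s / real n))))"
    using p1 by (intro divide_left_mono) auto
  then have second: "1 / (1 - p) ^ (a * a) \<le> exp (2 * \<beta>\<^sup>2 * (L * (real s / real n)))"
    by (simp add: exp_minus inverse_eq_divide)
  show ?thesis
    using prob_isolated_residue_class_ge[OF bounds(1,2) p(1) p1 a_def] first second by linarith
qed

lemma residue_cliques_disconnected_aas:
  fixes s :: "nat \<Rightarrow> nat"
  assumes s_inf: "filterlim s at_top sequentially" and s0: "(\<lambda>n. real (s n) / real n) \<longlonglongrightarrow> 0"
  shows "\<exists>\<epsilon> :: nat \<Rightarrow> real. \<epsilon> \<longlonglongrightarrow> 0 \<and>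
    (\<forall>p :: nat \<Rightarrow> real. (\<forall>n. 0 \<le> p n \<and> p n \<le> 1) \<longrightarrow>
      (\<forall>\<^sub>F n in sequentially.
         p n \<le> (1 - \<epsilon> n) * ln (real n / real (s n)) / (real n * real (s n))) \<longrightarrow>
      (\<lambda>n. measure_pmf.prob (binomial_random_graph n (p n))
         {R. vertex_connectivity {..<n} (residue_cliques n (n div (s n + 1)) \<union> R) = 0})
        \<longlonglongrightarrow> 1)"
proof -
  define L where "L n = ln (real n / real (s n))" for n
  define P where "P n = ln (real n / real (s n)) / (real n * real (s n))" for n
  define \<beta> where "\<beta> n = (1 + 1 / real (s n)) / (1 - real (s n) / real n - 1 / real n) + 1 / real (s n)"
    for n
  define \<theta> where "\<theta> n = \<beta> n / (1 - P n)" for n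
  \<comment> \<open>When \<open>\<theta> n\<close> is positive, this is the least nonnegative value
    with \<open>(1 - \<epsilon> n) * \<theta> n \<le> 1 - 1 / sqrt (L n)\<close>. It depends on
    \<open>s\<close> only, hence is fixed before \<open>p\<close>, and tends to 0 because \<theta>
    tends to 1 and \<open>L\<close> to infinity.\<close>
  define \<epsilon> where "\<epsilon> n = max 0 (1 - (1 - 1 / sqrt (L n)) / \<theta> n)" for n
  have s_pos: "\<forall>\<^sub>F n in sequentially. 0 < s n"
    by (rule eventually_compose_filterlim[OF eventually_gt_at_top s_inf])
  have rs: "filterlim (\<lambda>n. real (s n)) at_top sequentially"
    using s_inf filterlim_compose[OF filterlim_real_sequentially] by blast
  have inv_s: "(\<lambda>n. 1 / real (s n)) \<longlonglongrightarrow> 0"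
    using tendsto_divide_0[OF tendsto_const filterlim_at_top_imp_at_infinity[OF rs]] .
  have inv_n: "(\<lambda>n. 1 / real n) \<longlonglongrightarrow> 0" by (rule lim_const_over_n)
  have ratio: "filterlim (\<lambda>n. real n / real (s n)) at_top sequentially"
  proof -
    have "\<forall>\<^sub>F n in sequentially. 0 < real (s n) / real n"
      using s_pos eventually_gt_at_top[of 0] by eventually_elim simp
    then have "filterlim (\<lambda>n. inverse (real (s n) / real n)) at_top sequentially"
      by (rule filterlim_inverse_at_top[OF s0])
    then show ?thesis by simp
  qed
  have L_inf: "filterlim L at_top sequentially"
    unfolding L_def by (rule filterlim_compose[OF ln_at_top ratio])
  have sqrtL: "filterlim (\<lambda>n. sqrt (L n)) at_top sequentially"
    by (rule filterlim_compose[OF sqrt_at_top L_inf])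
  have inv_sqrtL: "(\<lambda>n. 1 / sqrt (L n)) \<longlonglongrightarrow> 0"
    using tendsto_divide_0[OF tendsto_const filterlim_at_top_imp_at_infinity[OF sqrtL]] .
  have exp_sqrtL: "(\<lambda>n. exp (- sqrt (L n))) \<longlonglongrightarrow> 0"
    by (rule filterlim_compose[OF exp_at_bot]) (simp add: filterlim_uminus_at_top[symmetric] sqrtL)
  have Ls: "(\<lambda>n. L n * (real (s n) / real n)) \<longlonglongrightarrow> 0"
  proof -
    have "((\<lambda>x :: real. ln x / x) \<longlongrightarrow> 0) at_top" by (rule ln_x_over_x_tendsto_0)
    from filterlim_compose[OF this ratio] show ?thesis by (simp add: L_def)
  qed
  \<comment> \<open>\<open>P n\<close> is \<open>L n * (s n / n)\<close> divided by the square of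
    \<open>s n\<close>.\<close>
  have P_lim: "P \<longlonglongrightarrow> 0"
  proof (rule Lim_transform_eventually)
    have "(\<lambda>n. L n * (real (s n) / real n) * (1 / real (s n) * (1 / real (s n)))) \<longlonglongrightarrow> 0 * (0 * 0)"
      by (intro tendsto_intros Ls inv_s)
    then show "(\<lambda>n. L n * (real (s n) / real n) * (1 / real (s n) * (1 / real (s n)))) \<longlonglongrightarrow> 0" by simp
    show "\<forall>\<^sub>F n in sequentially. L n * (real (s n) / real n) * (1 / real (s n) * (1 / real (s n))) = P n"
      using s_pos by eventually_elim (simp add: L_def P_def field_simps)
  qed
  have \<beta>_lim: "\<beta> \<longlonglongrightarrow> 1"
  proof -
    have "\<beta> \<longlonglongrightarrow> (1 + 0) / (1 - 0 - 0) + 0"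
      unfolding \<beta>_def by (intro tendsto_intros inv_s inv_n s0) auto
    then show ?thesis by simp
  qed
  have \<theta>_lim: "\<theta> \<longlonglongrightarrow> 1"
  proof -
    have "\<theta> \<longlonglongrightarrow> 1 / (1 - 0)" unfolding \<theta>_def by (intro tendsto_intros \<beta>_lim P_lim) auto
    then show ?thesis by simp
  qed
  have "\<epsilon> \<longlonglongrightarrow> max 0 (1 - (1 - 0) / 1)"
    unfolding \<epsilon>_def by (intro tendsto_intros tendsto_max inv_sqrtL \<theta>_lim) auto
  then have \<epsilon>_lim: "\<epsilon> \<longlonglongrightarrow> 0" by simp
  have big: "\<forall>\<^sub>F n in sequentially. 2 * (s n + 1) \<le> n"
  proof -
    have "(\<lambda>n. real (s n) / real n + 1 / real n) \<longlonglongrightarrow> 0 + 0" by (intro tendsto_intros s0 inv_n)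
    then have "\<forall>\<^sub>F n in sequentially. real (s n) / real n + 1 / real n < 1 / 2"
      by (rule order_tendstoD) simp
    then show ?thesis
      using eventually_gt_at_top[of 0] by eventually_elim (simp add: field_simps)
  qed
  have "(\<lambda>n. measure_pmf.prob (binomial_random_graph n (p n))
      {R. vertex_connectivity {..<n} (residue_cliques n (n div (s n + 1)) \<union> R) = 0}) \<longlonglongrightarrow> 1"
    if p01: "\<forall>n. 0 \<le> p n \<and> p n \<le> 1"
      and p: "\<forall>\<^sub>F n in sequentially.
         p n \<le> (1 - \<epsilon> n) * ln (real n / real (s n)) / (real n * real (s n))" for p
  proof (rule tendsto_sandwich)
    have "(\<lambda>n. 2 - 4 * exp (- sqrt (L n)) - exp (2 * (\<beta> n)\<^sup>2 * (L n * (real (s n) / real n))))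
        \<longlonglongrightarrow> 2 - 4 * 0 - exp (2 * 1\<^sup>2 * 0)"
      by (intro tendsto_intros exp_sqrtL \<beta>_lim Ls)
    then show "(\<lambda>n. 2 - 4 * exp (- sqrt (L n)) - exp (2 * (\<beta> n)\<^sup>2 * (L n * (real (s n) / real n))))
        \<longlonglongrightarrow> 1" by simp
    have "\<forall>\<^sub>F n in sequentially. P n < 1 / 2" "\<forall>\<^sub>F n in sequentially. 0 < \<theta> n"
      using order_tendstoD(2)[OF P_lim, of "1 / 2"] order_tendstoD(1)[OF \<theta>_lim, of 0] by simp_all
    then show "\<forall>\<^sub>F n in sequentially.
        2 - 4 * exp (- sqrt (L n)) - exp (2 * (\<beta> n)\<^sup>2 * (L n * (real (s n) / real n))) \<le>
        measure_pmf.prob (binomial_random_graph n (p n))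
          {R. vertex_connectivity {..<n} (residue_cliques n (n div (s n + 1)) \<union> R) = 0}"
      using s_pos big p
    proof eventually_elim
      case (elim n)
      have "1 - \<epsilon> n \<le> (1 - 1 / sqrt (L n)) / \<theta> n" unfolding \<epsilon>_def by simp
      then have "(1 - \<epsilon> n) * \<theta> n \<le> 1 - 1 / sqrt (L n)" using elim(2) by (simp add: pos_le_divide_eq)
      then show ?case
        unfolding L_def \<beta>_def
        using elim p01 by (intro prob_disconnected_ge[where \<epsilon> = "\<epsilon> n"])
          (auto simp: \<epsilon>_def \<theta>_def P_def L_def \<beta>_def)
    qed
  qed auto
  then show ?thesis using \<epsilon>_lim by blast
qed

section \<open>Choice of the constant 64 and of the extremal graphs\<close>

theorem theorem1p6:
  shows
    "(\<exists>c0::real. c0 > 0 \<and> (\<forall>c\<ge>c0.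
        \<forall>(k :: nat \<Rightarrow> nat) (s :: nat \<Rightarrow> nat) (G :: nat \<Rightarrow> nat set set) (p :: nat \<Rightarrow> real).
          (\<forall>n>0. 0 < k n \<and> 0 < s n \<and> real (k n) \<le> real (s n) / 17) \<longrightarrow>
          (\<lambda>n. real (s n) / real n) \<longlonglongrightarrow> 0 \<longrightarrow>
          (\<forall>\<^sub>F n in sequentially.
             simple_graph {..<n} (G n) \<and> min_degree {..<n} (G n) = s n) \<longrightarrow>
          (\<forall>n. 0 \<le> p n \<and> p n \<le> 1) \<longrightarrow>
          (\<forall>\<^sub>F n in sequentially.
             p n \<ge> c * (real (k n) + ln (real n / real (s n))) / (real n * real (s n))) \<longrightarrow>
          (\<lambda>n. measure_pmf.prob (binomial_random_graph n (p n))
                 {R. vertex_connectivity {..<n} (G n \<union> R) \<ge> k n}) \<longlonglongrightarrow> 1))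
     \<and>
     (\<forall>(k :: nat \<Rightarrow> nat) (s :: nat \<Rightarrow> nat).
        (\<forall>n>0. 0 < k n \<and> 0 < s n \<and> real (k n) \<le> real (s n) / 17) \<longrightarrow>
        (\<exists>G0 :: nat \<Rightarrow> nat set set.
          (\<forall>n. 2 * (s n + 1) \<le> n \<longrightarrow>
             simple_graph {..<n} (G0 n) \<and> min_degree {..<n} (G0 n) \<ge> s n \<and>
             (\<forall>H. simple_graph {..<n} H \<longrightarrow>
                real (card H) < real (k n) * of_int \<lfloor>real n / (real (s n) + 1)\<rfloor> / 2 \<longrightarrow>
                vertex_connectivity {..<n} (G0 n \<union> H) < k n)) \<and>
          (filterlim s at_top sequentially \<longrightarrow>
           (\<lambda>n. real (s n) / real n) \<longlonglongrightarrow> 0 \<longrightarrow>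
           (\<exists>\<epsilon> :: nat \<Rightarrow> real. \<epsilon> \<longlonglongrightarrow> 0 \<and>
             (\<forall>p :: nat \<Rightarrow> real.
                (\<forall>n. 0 \<le> p n \<and> p n \<le> 1) \<longrightarrow>
                (\<forall>\<^sub>F n in sequentially.
                   p n \<le> (1 - \<epsilon> n) * ln (real n / real (s n)) / (real n * real (s n))) \<longrightarrow>
                (\<lambda>n. measure_pmf.prob (binomial_random_graph n (p n))
                       {R. vertex_connectivity {..<n} (G0 n \<union> R) = 0}) \<longlonglongrightarrow> 1)))))"
proof (intro conjI allI impI, goal_cases)
  case 1
  show ?case
  proof (intro exI[of _ 64] conjI allI impI, goal_cases)
    case (2 c k s G p)
    show ?case
      by (rule perturbed_vertex_connectivity_aas
          [OF 2(1) 2(2)[rule_format] 2(3,4) 2(5)[rule_format] 2(6)])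
  qed simp
next
  case (2 k s)
  then have ks: "\<forall>n>0. 0 < k n \<and> 0 < s n \<and> real (k n) \<le> real (s n) / 17" .
  define G0 where "G0 n = residue_cliques n (n div (s n + 1))" for n
  have clique_bound: "simple_graph {..<n} (G0 n) \<and> min_degree {..<n} (G0 n) \<ge> s n \<and>
      (\<forall>H. simple_graph {..<n} H \<longrightarrow>
        real (card H) < real (k n) * of_int \<lfloor>real n / (real (s n) + 1)\<rfloor> / 2 \<longrightarrow>
        vertex_connectivity {..<n} (G0 n \<union> H) < k n)"
    if n: "2 * (s n + 1) \<le> n" for n
  proof (intro conjI allI impI)
    define m where "m = n div (s n + 1)"
    have n0: "0 < n" using n by simp
    then have "0 < s n \<and> real (k n) \<le> real (s n) / 17" using ks by blast
    then have ks': "0 < s n" "k n \<le> s n" by auto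
    \<comment> \<open>The assumption \<open>2 * (s n + 1) \<le> n\<close> guarantees at least two
      cliques.\<close>
    note m = div_div_Suc_bounds(1,2)[OF ks'(1) n, folded m_def]
    have "(s n + 1) * m \<le> n" unfolding m_def by (rule times_div_less_eq_dividend)
    \<comment> \<open>Every clique has at least \<open>s n + 1\<close> vertices, which gives both
      the minimum degree and \<open>k n \<le> n div m\<close>.\<close>
    then have nm: "s n + 1 \<le> n div m" using m by (simp add: less_eq_div_iff_mult_less_eq)
    show "simple_graph {..<n} (G0 n)" unfolding G0_def by (rule simple_graph_residue_cliques)
    have "n div m - 1 \<le> min_degree {..<n} (G0 n)"
      unfolding G0_def m_def[symmetric] using n0 m by (intro min_degree_residue_cliques_ge) auto
    then show "s n \<le> min_degree {..<n} (G0 n)" using nm by linarith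
    fix H assume H: "simple_graph {..<n} H"
      "real (card H) < real (k n) * of_int \<lfloor>real n / (real (s n) + 1)\<rfloor> / 2"
    have "\<lfloor>real n / (real (s n) + 1)\<rfloor> = int m"
      unfolding m_def using floor_divide_of_nat_eq[of n "s n + 1", where 'a = real]
      by (simp add: add.commute)
    then have "real (2 * card H) < real (k n * m)" using H(2) by simp
    then have "2 * card H < k n * m" by (simp only: of_nat_less_iff)
    then show "vertex_connectivity {..<n} (G0 n \<union> H) < k n"
      unfolding G0_def m_def[symmetric] using m ks' nm H(1)
      by (intro vertex_connectivity_residue_cliques_Un_less) auto
  qed
  show ?case
  proof (rule exI[of _ G0], rule conjI, goal_cases)
    case 1
    show ?case by (intro allI impI) (rule clique_bound)
  next
    case 2
    show ?case by (intro impI) (rule residue_cliques_disconnected_aas[of s, folded G0_def])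
  qed
qed

end
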